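(* There are numerical constants $c_0,c_1>0$ such that, for every $\ell,D_{\mathcal Y},\Delta,\epsilon>0$ satisfying $\epsilon\le c_0\min\{\ell D_{\mathcal Y},\sqrt{\ell\Delta}\}$, one has $$\mathcal T_\epsilon\bigl(\mathcal A_{\rm det},\mathcal F(\ell,D_{\mathcal Y},\Delta)\bigr)\ \ge\ c_1\,\frac{\ell^2D_{\mathcal Y}\Delta}{\epsilon^3}.$$
   Context: All norms are Euclidean. Function class. For $\ell,D_{\mathcal Y},\Delta>0$, $\mathcal F(\ell,D_{\mathcal Y},\Delta)$ is the class of all functions $f:\mathcal X\times\mathcal Y\to\mathbb R$, over all $m,n\in\mathbb N$ and all nonempty closed convex $\mathcal X\subseteq\mathbb R^m$, $\mathcal Y\subseteq\mathbb R^n$ with $(\mathbf 0,\mathbf 0)\in\mathcal X\times\mathcal Y$ and $\operatorname{diam}(\mathcal Y)\le D_{\mathcal Y}$, such that: (i) $f$ is jointly $\ell$-smooth: $\|\nabla f(x_1;y_1)-\nabla f(x_2;y_2)\|\le\ell\|(x_1,y_1)-(x_2,y_2)\|$ on $\mathcal X\times\mathcal Y$; (ii) $f(x;\cdot)$ is concave on $\mathcal Y$ for every $x\in\mathcal X$; (iii) $\Phi(\mathbf 0)-\inf_{x\in\mathcal X}\Phi(x)\le\Delta$, where $\Phi(x):=\max_{y\in\mathcal Y}f(x;y)+\iota_{\mathcal X}(x)$ and $\iota_{\mathcal X}$ is $0$ on $\mathcal X$ and $+\infty$ outside. Stationarity. The Moreau envelope is $\Phi_{1/(2\ell)}(x):=\min_{z\in\mathbb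 R^m}\{\Phi(z)+\ell\|x-z\|^2\}$. A point $x\in\mathcal X$ is $\epsilon$-OS for $f$ if $\|\nabla\Phi_{1/(2\ell)}(x)\|\le\epsilon$. Oracle and algorithms. The first-order saddle oracle at $(x,y)\in\mathcal X\times\mathcal Y$ returns $\mathbb O_f(x;y)=(f(x;y),\nabla_xf(x;y),\nabla_yf(x;y))$. For a first-order algorithm $\mathsf A$ and a differentiable $f:\mathcal X\times\mathcal Y\to\mathbb R$, $(\mathsf A_x^{(t)}[f],\mathsf A_y^{(t)}[f])\in\mathcal X\times\mathcal Y$ is its $t$-th (feasible) query, $t=0,1,2,\dots$; the domain $\mathcal X\times\mathcal Y$ is known to the algorithm. $\mathcal A_{\rm det}$ (deterministic algorithms): there are maps $\{\Gamma_t\}_{t\ge1}$ such that for every $f$ the initial query is $(\mathbf 0,\mathbf 0)$ and for $t\ge1$ the $t$-th query equals $\Gamma_t\bigl((\mathbb O_f(\mathsf A_x^{(s)}[f];\mathsf A_y^{(s)}[f]))_{s<t}\bigr)$. Complexity. For nonempty $\mathcal A\subseteq\mathcal A_{\rm det}$ and a nonempty function class $\mathcal G$, $\mathcal T_\epsilon(\mathcal A,\mathcal G):=\inf_{\mathsf A\in\mathcal A}\sup_{f\in\mathcal G}\inf\{t\in\{0,1,2,\dots\}:\mathsf A_x^{(t)}[f]\text{ is }\epsilon\text{-OS for }f\}$ (with $\inf\varnothing=+\infty$). *)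

theory Defs
  imports "HOL-Analysis.Analysis"
begin

text \<open>
  The function class ranges over all dimensions and one algorithm has to serve all of them, so
  the dimension must be a value rather than a type. All the spaces \<open>\<real>\<^sup>m\<close> are therefore realised
  inside one real inner product space, the finitely supported real sequences with the Euclidean
  inner product; \<open>\<real>\<^sup>m\<close> is the subspace of sequences vanishing from index \<open>m\<close> on. (The library's
  finitely supported functions \<open>poly_mapping\<close> carry the 1-norm instead.) As \<open>\<real>\<^sup>m\<close> is a
  finite-dimensional subspace, closedness of a subset of \<open>\<real>\<^sup>m\<close> does not depend on whether it is
  taken in \<open>\<real>\<^sup>m\<close> or in the ambient space.
\<close>

typedef fvec = "{x :: nat \<Rightarrow> real. finite {i. x i \<noteq> 0}}"
  morphisms coord Abs_fvec
  by (rule exI[of _ "\<lambda>_. 0"]) simp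

setup_lifting type_definition_fvec

lemma fvec_eqI: "(\<And>i. coord x i = coord y i) \<Longrightarrow> x = y"
  by (simp add: coord_inject[symmetric] fun_eq_iff)

lemma finite_coord: "finite {i. coord x i \<noteq> 0}"
  using coord[of x] by simp

instantiation fvec :: real_vector
begin

lift_definition zero_fvec :: fvec is "\<lambda>_. 0"
  by simp

lift_definition plus_fvec :: "fvec \<Rightarrow> fvec \<Rightarrow> fvec" is "\<lambda>x y i. x i + y i"
  by (erule (1) finite_subset[OF _ finite_UnI, rotated]) auto

lift_definition minus_fvec :: "fvec \<Rightarrow> fvec \<Rightarrow> fvec" is "\<lambda>x y i. x i - y i"
  by (erule (1) finite_subset[OF _ finite_UnI, rotated]) auto

lift_definition uminus_fvec :: "fvec \<Rightarrow> fvec" is "\<lambda>x i. - x i"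
  by simp

lift_definition scaleR_fvec :: "real \<Rightarrow> fvec \<Rightarrow> fvec" is "\<lambda>r x i. r * x i"
  by (erule finite_subset[rotated]) auto

instance
  by standard (transfer; simp add: fun_eq_iff algebra_simps)+

end

lemma coord_simps [simp]:
  "coord 0 i = 0"
  "coord (x + y) i = coord x i + coord y i"
  "coord (x - y) i = coord x i - coord y i"
  "coord (- x) i = - coord x i"
  "coord (r *\<^sub>R x) i = r * coord x i"
  by (transfer; simp)+

instantiation fvec :: real_inner
begin

definition inner_fvec :: "fvec \<Rightarrow> fvec \<Rightarrow> real" where
  "inner_fvec x y = (\<Sum>i | coord x i \<noteq> 0. coord x i * coord y i)"

definition norm_fvec :: "fvec \<Rightarrow> real" where
  "norm_fvec x = sqrt (inner x x)"

definition dist_fvec :: "fvec \<Rightarrow> fvec \<Rightarrow> real" where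
  "dist_fvec x y = norm (x - y)"

definition sgn_fvec :: "fvec \<Rightarrow> fvec" where
  "sgn_fvec x = x /\<^sub>R norm x"

definition uniformity_fvec :: "(fvec \<times> fvec) filter" where
  "uniformity_fvec = (INF e\<in>{0<..}. principal {(x, y). dist x y < e})"

definition open_fvec :: "fvec set \<Rightarrow> bool" where
  "open_fvec U \<longleftrightarrow> (\<forall>x\<in>U. \<forall>\<^sub>F (x', y) in uniformity. x' = x \<longrightarrow> y \<in> U)"

lemma inner_fvec_superset:
  assumes "finite A" "{i. coord x i \<noteq> 0} \<subseteq> A"
  shows "inner x y = (\<Sum>i\<in>A. coord x i * coord y i)"
  unfolding inner_fvec_def using assms by (intro sum.mono_neutral_left) auto

instance
proof
  fix x y z :: fvec and r :: real
  let ?A = "{i. coord x i \<noteq> 0} \<union> {i. coord y i \<noteq> 0}"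
  have fin: "finite ?A" by (simp add: finite_coord)
  show "inner x y = inner y x"
    by (simp add: inner_fvec_superset[OF fin] mult.commute)
  have "{i. coord (x + y) i \<noteq> 0} \<subseteq> ?A" by auto
  then show "inner (x + y) z = inner x z + inner y z"
    by (simp add: inner_fvec_superset[OF fin] sum.distrib algebra_simps)
  have "{i. coord (r *\<^sub>R x) i \<noteq> 0} \<subseteq> ?A" by auto
  then show "inner (r *\<^sub>R x) y = r * inner x y"
    by (simp add: inner_fvec_superset[OF fin] sum_distrib_left algebra_simps)
  show "0 \<le> inner x x"
    unfolding inner_fvec_def by (intro sum_nonneg) simp
  show "inner x x = 0 \<longleftrightarrow> x = 0"
    unfolding inner_fvec_def
    by (subst sum_nonneg_eq_0_iff) (auto simp: finite_coord intro!: fvec_eqI)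
qed (simp_all add: norm_fvec_def dist_fvec_def sgn_fvec_def uniformity_fvec_def open_fvec_def)

end

definition Rn :: "nat \<Rightarrow> fvec set" where
  "Rn m = {x. \<forall>i\<ge>m. coord x i = 0}"

lemma inner_Rn: "x \<in> Rn m \<Longrightarrow> inner x y = (\<Sum>i<m. coord x i * coord y i)"
  by (rule inner_fvec_superset) (auto simp: Rn_def, meson leI)

text \<open>
  A function given only on a set \<open>S\<close> containing the origin determines the component of its
  gradient in the span of \<open>S\<close> and nothing more, so the gradient is taken in that span. If
  \<open>S \<subseteq> \<real>\<^sup>k\<close> is convex with nonempty interior in \<open>\<real>\<^sup>k\<close>, this is the usual gradient; on a convex
  set it is unique in all cases (lemma \<open>has_gradient_unique\<close>).
\<close>

definition has_gradient ::
  "'a::real_inner set \<Rightarrow> ('a \<Rightarrow> real) \<Rightarrow> 'a \<Rightarrow> 'a \<Rightarrow> bool" where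
  "has_gradient S f z g \<longleftrightarrow> g \<in> span S \<and> (f has_derivative (\<lambda>h. inner g h)) (at z within S)"

definition gradient :: "'a::real_inner set \<Rightarrow> ('a \<Rightarrow> real) \<Rightarrow> 'a \<Rightarrow> 'a" where
  "gradient S f z = (THE g. has_gradient S f z g)"

lemma has_gradient_unique:
  fixes S :: "'a::real_inner set"
  assumes "convex S" "0 \<in> S" "z \<in> S" "has_gradient S f z g" "has_gradient S f z g'"
  shows "g = g'"
proof -
  have dir: "inner g (w - z) = inner g' (w - z)" if w: "w \<in> S" for w
  proof -
    define p where "p = (\<lambda>t::real. z + t *\<^sub>R (w - z))"
    have sub: "p ` {0..1} \<subseteq> S"
    proof
      fix u assume "u \<in> p ` {0..1}"
      then obtain t where t: "0 \<le> t" "t \<le> 1" "u = (1 - t) *\<^sub>R z + t *\<^sub>R w"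
        by (auto simp: p_def algebra_simps)
      then show "u \<in> S"
        using convexD[OF assms(1,3) w, of "1 - t" t] by simp
    qed
    have dp: "(p has_derivative (\<lambda>t. t *\<^sub>R (w - z))) (at 0 within {0..1})"
      unfolding p_def by (auto intro!: derivative_eq_intros)
    have d: "((f \<circ> p) has_vector_derivative inner h (w - z)) (at 0 within {0..1})"
      if "has_gradient S f z h" for h
    proof -
      have "(f has_derivative (\<lambda>v. inner h v)) (at (p 0) within p ` {0..1})"
        using that has_derivative_subset[OF _ sub, of f "inner h" z]
        by (simp add: has_gradient_def p_def)
      from diff_chain_within[OF dp this] show ?thesis
        by (simp add: has_vector_derivative_def o_def)
    qed
    show ?thesis
      using vector_derivative_unique_within[OF _ d[OF assms(4)] d[OF assms(5)]]
      by (simp add: trivial_limit_within islimpt_finite)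
  qed
  have orth: "inner (g - g') w = 0" if "w \<in> S" for w
    using dir[OF that] dir[OF assms(2)] by (simp add: inner_diff_left inner_diff_right)
  have "inner (g - g') u = 0" if "u \<in> span S" for u
    using that orth by (induction rule: span_induct) (auto simp: subspace_def inner_add_right)
  moreover have "g - g' \<in> span S"
    using assms(4,5) by (auto simp: has_gradient_def intro: span_diff)
  ultimately have "inner (g - g') (g - g') = 0"
    by blast
  then show ?thesis by simp
qed

record saddle_domain =
  dimX :: nat
  dimY :: nat
  setX :: "fvec set"
  setY :: "fvec set"

definition dom_XY :: "saddle_domain \<Rightarrow> (fvec \<times> fvec) set" where
  "dom_XY d = setX d \<times> setY d"

definition admissible_domain :: "saddle_domain \<Rightarrow> bool" where
  "admissible_domain d \<longleftrightarrow>
     setX d \<subseteq> Rn (dimX d) \<and> closed (setX d) \<and> convex (setX d) \<and>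
     setY d \<subseteq> Rn (dimY d) \<and> closed (setY d) \<and> convex (setY d) \<and>
     (0, 0) \<in> dom_XY d"

text \<open>
  Objectives are total functions in HOL, but only their values on \<open>X \<times> Y\<close> are ever used.
\<close>

type_synonym objective = "fvec \<times> fvec \<Rightarrow> real"

definition differentiable_obj :: "saddle_domain \<Rightarrow> objective \<Rightarrow> bool" where
  "differentiable_obj d f \<longleftrightarrow> (\<forall>z\<in>dom_XY d. \<exists>g. has_gradient (dom_XY d) f z g)"

definition smooth_obj :: "real \<Rightarrow> saddle_domain \<Rightarrow> objective \<Rightarrow> bool" where
  "smooth_obj l d f \<longleftrightarrow> differentiable_obj d f \<and>
     (\<forall>z\<in>dom_XY d. \<forall>z'\<in>dom_XY d.
        norm (gradient (dom_XY d) f z - gradient (dom_XY d) f z') \<le> l * norm (z - z'))"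

text \<open>
  The supremum is a maximum for the functions in the class below, because there \<open>Y\<close> is compact
  and \<open>f\<close> is continuous.
\<close>

definition Phi :: "saddle_domain \<Rightarrow> objective \<Rightarrow> fvec \<Rightarrow> ereal" where
  "Phi d f x = (if x \<in> setX d then (SUP y\<in>setY d. ereal (f (x, y))) else \<infinity>)"

text \<open>
  The library's \<open>diameter\<close> is meaningful for bounded sets only, hence the explicit boundedness.
\<close>

definition saddle_class :: "real \<Rightarrow> real \<Rightarrow> real \<Rightarrow> (saddle_domain \<times> objective) set" where
  "saddle_class l D \<Delta> = {(d, f).
     admissible_domain d \<and> bounded (setY d) \<and> diameter (setY d) \<le> D \<and>
     smooth_obj l d f \<and>
     (\<forall>x\<in>setX d. concave_on (setY d) (\<lambda>y. f (x, y))) \<and>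
     Phi d f 0 - (INF x\<in>setX d. Phi d f x) \<le> ereal \<Delta>}"

definition moreau_envelope :: "real \<Rightarrow> saddle_domain \<Rightarrow> objective \<Rightarrow> fvec \<Rightarrow> ereal" where
  "moreau_envelope l d f x =
     (INF z\<in>Rn (dimX d). Phi d f z + ereal (l * (norm (x - z))\<^sup>2))"

text \<open>
  \<open>moreau_envelope l d f\<close> is the envelope with parameter \<open>1/(2l)\<close>. For functions in
  \<open>saddle_class l D \<Delta>\<close> it is finite and differentiable on \<open>\<real>\<^sup>m\<close>, and the infimum is attained.
\<close>

definition eps_OS :: "real \<Rightarrow> real \<Rightarrow> saddle_domain \<Rightarrow> objective \<Rightarrow> fvec \<Rightarrow> bool" where
  "eps_OS l \<epsilon> d f x \<longleftrightarrow> x \<in> setX d \<and>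
     (\<exists>g. has_gradient (Rn (dimX d)) (\<lambda>u. real_of_ereal (moreau_envelope l d f u)) x g \<and>
          norm g \<le> \<epsilon>)"

definition oracle_answer ::
  "saddle_domain \<Rightarrow> objective \<Rightarrow> fvec \<times> fvec \<Rightarrow> real \<times> fvec \<times> fvec" where
  "oracle_answer d f z =
     (f z, fst (gradient (dom_XY d) f z), snd (gradient (dom_XY d) f z))"

text \<open>
  \<open>A d f t\<close> is the \<open>t\<close>-th query of the algorithm \<open>A\<close> on the objective \<open>f\<close> with domain \<open>d\<close>.
\<close>

type_synonym algorithm = "saddle_domain \<Rightarrow> objective \<Rightarrow> nat \<Rightarrow> fvec \<times> fvec"

definition first_order_algorithm :: "algorithm \<Rightarrow> bool" where
  "first_order_algorithm A \<longleftrightarrow>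
     (\<forall>d f t. admissible_domain d \<and> differentiable_obj d f \<longrightarrow> A d f t \<in> dom_XY d)"

text \<open>
  The domain, including the dimensions, is known to the algorithm, so the maps \<open>\<Gamma> t\<close> may depend
  on it; they see \<open>f\<close> only through the list of the \<open>t\<close> previous oracle answers.
\<close>

definition A_det :: "algorithm set" where
  "A_det = {A. first_order_algorithm A \<and>
     (\<exists>\<Gamma> :: nat \<Rightarrow> saddle_domain \<Rightarrow> (real \<times> fvec \<times> fvec) list \<Rightarrow> fvec \<times> fvec.
        \<forall>d f. admissible_domain d \<and> differentiable_obj d f \<longrightarrow>
          A d f 0 = (0, 0) \<and>
          (\<forall>t\<ge>1. A d f t = \<Gamma> t d (map (\<lambda>s. oracle_answer d f (A d f s)) [0..<t])))}"

text \<open>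
  Infima over the empty set are \<open>\<infinity>\<close> in \<open>ereal\<close>, as required for the hitting time.
\<close>

definition hitting_time ::
  "real \<Rightarrow> real \<Rightarrow> algorithm \<Rightarrow> saddle_domain \<Rightarrow> objective \<Rightarrow> ereal" where
  "hitting_time l \<epsilon> A d f = (INF t\<in>{t::nat. eps_OS l \<epsilon> d f (fst (A d f t))}. ereal (real t))"

definition complexity ::
  "real \<Rightarrow> real \<Rightarrow> algorithm set \<Rightarrow> (saddle_domain \<times> objective) set \<Rightarrow> ereal" where
  "complexity l \<epsilon> \<A> \<G> = (INF A\<in>\<A>. SUP (d, f)\<in>\<G>. hitting_time l \<epsilon> A d f)"

end

theory Submission
  imports Defs
begin

text \<open>
  The primal coordinates form \<open>T\<close> blocks of \<open>K + 1\<close> coordinates, with \<open>T\<close> of order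
  \<open>l \<Delta> / \<epsilon>\<^sup>2\<close> and \<open>K\<close> of order \<open>l D / \<epsilon>\<close>. A nonconvex potential links the first coordinate of
  each block to the last one of the preceding block: at a point that is constant on each block
  up to weights, unless all blocks have been raised to a level \<open>r\<close> of order \<open>\<epsilon> / l\<close>, raising some
  block jointly decreases the potential at a rate above \<open>\<epsilon>\<close>. The dual variable ranges over one ball of diameter \<open>D\<close> and is coupled
  bilinearly to the jumps inside all blocks, so that maximizing over it adds an exact penalty,
  a multiple of \<open>l D\<close> times the norm of the jumps. Its slope is at least of order
  \<open>l D / K\<close>, hence dominates \<open>\<epsilon>\<close>, and the proximal point of any \<open>\<epsilon>\<close>-stationary point has no
  jumps. An oracle call reveals at most one new coordinate, since a resisting oracle can choose
  the directions of the undiscovered coordinates orthogonally to all queries, and as long as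
  the last coordinate is undiscovered the query is not \<open>\<epsilon>\<close>-stationary. This costs \<open>T (K + 1)\<close>
  calls.
\<close>

subsection \<open>Finite-dimensional subspaces of finitely supported sequences\<close>

lemma abs_coord_le_norm: "\<bar>coord x i\<bar> \<le> norm x"
proof -
  have "(coord x i)\<^sup>2 \<le> inner x x"
  proof (cases "coord x i = 0")
    case False
    then have "coord x i * coord x i \<le> (\<Sum>i | coord x i \<noteq> 0. coord x i * coord x i)"
      by (intro member_le_sum) (auto simp: finite_coord)
    then show ?thesis by (simp add: inner_fvec_def power2_eq_square)
  qed simp
  then show ?thesis
    by (metis norm_eq_sqrt_inner real_sqrt_abs real_sqrt_le_mono)
qed

lemma continuous_on_coord: "continuous_on S (\<lambda>x. coord x i)"
proof -
  have "bounded_linear (\<lambda>x. coord x i)"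
    by (rule bounded_linear_intro[where K = 1]) (auto simp: abs_coord_le_norm)
  then show ?thesis by (rule linear_continuous_on)
qed

lemma subspace_Rn: "subspace (Rn m)"
  by (auto simp: Rn_def subspace_def)

lemma closed_Rn: "closed (Rn m)"
proof -
  have "Rn m = (\<Inter>i\<in>{m..}. {x. coord x i = 0})" by (auto simp: Rn_def)
  moreover have "closed {x. coord x i = 0}" for i
    using continuous_closed_preimage_constant[OF continuous_on_coord closed_UNIV, of i 0] by simp
  ultimately show ?thesis by auto
qed

lift_definition axis_fvec :: "nat \<Rightarrow> fvec" is "\<lambda>i j. if j = i then 1 else 0"
  by simp

lemma coord_axis_fvec [simp]: "coord (axis_fvec i) j = (if j = i then 1 else 0)"
  by transfer simp

lemma inner_axis_fvec: "inner (axis_fvec i) x = coord x i"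
proof -
  have "axis_fvec i \<in> Rn (Suc i)" by (auto simp: Rn_def)
  then show ?thesis by (simp add: inner_Rn if_distrib[of "\<lambda>c. c * _"] cong: if_cong)
qed

lemma norm_axis_fvec [simp]: "norm (axis_fvec i) = 1"
  by (simp add: norm_eq_sqrt_inner inner_axis_fvec)

lemma axis_fvec_in_Rn: "i < m \<Longrightarrow> axis_fvec i \<in> Rn m"
  by (auto simp: Rn_def)

lemma inj_axis_fvec: "inj axis_fvec"
  by (rule injI) (metis coord_axis_fvec zero_neq_one)

lemma Rn_expansion: "x \<in> Rn m \<Longrightarrow> x = (\<Sum>i<m. coord x i *\<^sub>R axis_fvec i)"
proof (rule fvec_eqI)
  fix j assume "x \<in> Rn m"
  have "coord (\<Sum>i<k. coord x i *\<^sub>R axis_fvec i) j = (if j < k then coord x j else 0)" for k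
    by (induction k) (auto simp: less_Suc_eq)
  then show "coord x j = coord (\<Sum>i<m. coord x i *\<^sub>R axis_fvec i) j"
    using \<open>x \<in> Rn m\<close> by (auto simp: Rn_def)
qed

lemma independent_axis_fvec: "independent (axis_fvec ` {..<m})"
proof (rule pairwise_orthogonal_independent)
  show "0 \<notin> axis_fvec ` {..<m}"
    by (metis imageE norm_axis_fvec norm_zero zero_neq_one)
qed (auto simp: pairwise_def orthogonal_def inner_axis_fvec)

lemma Rn_eq_span: "Rn m = span (axis_fvec ` {..<m})"
proof
  show "Rn m \<subseteq> span (axis_fvec ` {..<m})"
  proof
    fix x assume "x \<in> Rn m"
    then have "x = (\<Sum>i<m. coord x i *\<^sub>R axis_fvec i)" by (rule Rn_expansion)
    also have "\<dots> \<in> span (axis_fvec ` {..<m})"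
      by (intro span_sum span_mul span_base imageI)
    finally show "x \<in> span (axis_fvec ` {..<m})" .
  qed
  show "span (axis_fvec ` {..<m}) \<subseteq> Rn m"
    by (rule span_minimal) (auto simp: subspace_Rn axis_fvec_in_Rn)
qed

text \<open>Collecting the inner products with the \<open>s i\<close> gives a linear map of
  \<open>Rn m\<close> into the span of \<open>k\<close> axis vectors. For \<open>k < m\<close> it
  has a nonzero kernel vector, which is then normalized.\<close>

lemma unit_vector_orthogonal_exists:
  fixes s :: "nat \<Rightarrow> fvec"
  assumes "k < m"
  obtains u where "u \<in> Rn m" "norm u = 1" "\<And>i. i < k \<Longrightarrow> inner (s i) u = 0"
proof -
  define L where "L x = (\<Sum>i<k. inner (s i) x *\<^sub>R axis_fvec i)" for x
  have lin: "linear L"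
    by (rule linearI)
      (auto simp: L_def inner_add_right scaleR_add_left sum.distrib scaleR_sum_right)
  have "\<exists>u\<in>Rn m. u \<noteq> 0 \<and> L u = 0"
  proof (rule ccontr)
    assume "\<not> ?thesis"
    then have "inj_on L (Rn m)"
      by (subst linear_inj_on_iff_eq_0[OF lin subspace_Rn]) auto
    then have inj: "inj_on L (span (axis_fvec ` {..<m}))" by (simp add: Rn_eq_span)
    have ind: "independent (L ` axis_fvec ` {..<m})"
      using linear_independent_injective_image[OF lin independent_axis_fvec inj] .
    have "L x \<in> span (axis_fvec ` {..<k})" for x
      unfolding L_def by (intro span_sum span_mul span_base imageI)
    then have "L ` axis_fvec ` {..<m} \<subseteq> span (axis_fvec ` {..<k})" by blast
    from independent_span_bound[OF _ ind this]
    have "card (L ` axis_fvec ` {..<m}) \<le> card (axis_fvec ` {..<k})" by simp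
    moreover have "card (axis_fvec ` {..<n}) = n" for n
      by (simp add: card_image inj_on_subset[OF inj_axis_fvec])
    moreover have "card (L ` axis_fvec ` {..<m}) = card (axis_fvec ` {..<m})"
      by (intro card_image inj_on_subset[OF inj] span_superset)
    ultimately show False using assms by simp
  qed
  then obtain u where u: "u \<in> Rn m" "u \<noteq> 0" "L u = 0" by blast
  have "inner (s i) u = 0" if "i < k" for i
  proof -
    have "coord (L u) i = inner (axis_fvec i) (L u)" by (simp add: inner_axis_fvec)
    also have "\<dots> = inner (s i) u"
      using that
      by (simp add: L_def inner_sum_right inner_axis_fvec if_distrib[of "\<lambda>c. _ * c"] cong: if_cong)
    finally show ?thesis using u(3) by simp
  qed
  then show thesis
    using u that[of "u /\<^sub>R norm u"] by (simp add: subspace_scale[OF subspace_Rn])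
qed

text \<open>The ambient space is infinite-dimensional, so closed and bounded does not give compact.
  The box is built one coordinate at a time, as a continuous image of a smaller box times an
  interval.\<close>

lemma compact_box_Rn: "compact {x \<in> Rn m. \<forall>i<m. \<bar>coord x i\<bar> \<le> B}"
proof (induction m)
  case 0
  have "{x \<in> Rn 0. \<forall>i<0. \<bar>coord x i\<bar> \<le> B} = {0}"
    by (auto simp: Rn_def intro: fvec_eqI)
  then show ?case by simp
next
  case (Suc m)
  let ?S = "\<lambda>m. {x \<in> Rn m. \<forall>i<m. \<bar>coord x i\<bar> \<le> B}"
  have "?S (Suc m) = (\<lambda>(x, c). x + c *\<^sub>R axis_fvec m) ` (?S m \<times> {-B..B})"
  proof (intro equalityI subsetI)
    fix x assume x: "x \<in> ?S (Suc m)"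
    have "x = (\<lambda>(x, c). x + c *\<^sub>R axis_fvec m) (x - coord x m *\<^sub>R axis_fvec m, coord x m)" by simp
    moreover have "(x - coord x m *\<^sub>R axis_fvec m, coord x m) \<in> ?S m \<times> {-B..B}"
    proof -
      have "\<bar>coord x m\<bar> \<le> B" using x by auto
      moreover have "coord x i = 0" if "i \<ge> m" "i \<noteq> m" for i
        using x that by (auto simp: Rn_def)
      ultimately show ?thesis using x by (auto simp: Rn_def)
    qed
    ultimately show "x \<in> (\<lambda>(x, c). x + c *\<^sub>R axis_fvec m) ` (?S m \<times> {-B..B})" by blast
  qed (auto simp: Rn_def less_Suc_eq)
  moreover have "continuous_on (?S m \<times> {-B..B}) (\<lambda>(x, c). x + c *\<^sub>R axis_fvec m)"
    by (auto simp: split_beta intro!: continuous_intros)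
  ultimately show ?case
    by (simp only: compact_continuous_image compact_Times Suc compact_Icc)
qed

lemma coercive_attains_min_Rn:
  fixes h :: "fvec \<Rightarrow> real"
  assumes "continuous_on (Rn m) h" and coercive: "\<And>z. z \<in> Rn m \<Longrightarrow> norm z > B \<Longrightarrow> h 0 < h z"
  obtains z where "z \<in> Rn m" "\<And>z'. z' \<in> Rn m \<Longrightarrow> h z \<le> h z'"
proof -
  \<comment> \<open>\<open>max B 0\<close> keeps the origin in the box even for negative
    \<open>B\<close>.\<close>
  let ?S = "{x \<in> Rn m. \<forall>i<m. \<bar>coord x i\<bar> \<le> max B 0}"
  have 0: "0 \<in> ?S" by (auto simp: Rn_def)
  have "continuous_on ?S h" using assms(1) by (rule continuous_on_subset) auto
  from continuous_attains_inf[OF compact_box_Rn _ this] 0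
  obtain z where z: "z \<in> ?S" "\<And>z'. z' \<in> ?S \<Longrightarrow> h z \<le> h z'"
    by (metis (no_types, lifting) empty_iff)
  have "h z \<le> h z'" if z': "z' \<in> Rn m" for z'
  proof (cases "norm z' > B")
    case True
    then show ?thesis using coercive[OF z'] z(2)[OF 0] by simp
  next
    case False
    then have "\<bar>coord z' i\<bar> \<le> max B 0" for i
      using abs_coord_le_norm[of z' i] by linarith
    then have "z' \<in> ?S" using z' by blast
    then show ?thesis by (rule z(2))
  qed
  then show thesis using z(1) that by blast
qed

subsection \<open>The nonconvex link function\<close>

text \<open>A quadratic spline rising from 0 at \<open>t = 0\<close> to 1 at \<open>t = 1\<close>;
  its derivative is a tent with slopes 4 and -4 and peak 2 at \<open>1/2\<close>.\<close>

definition step :: "real \<Rightarrow> real" where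
  "step t = 2 * (max 0 t)\<^sup>2 - 4 * (max 0 (t - 1/2))\<^sup>2 + 2 * (max 0 (t - 1))\<^sup>2"

definition step_deriv :: "real \<Rightarrow> real" where
  "step_deriv t = 4 * max 0 t - 8 * max 0 (t - 1/2) + 4 * max 0 (t - 1)"

lemma DERIV_max_0_square:
  "((\<lambda>t::real. (max 0 t)\<^sup>2) has_real_derivative 2 * max 0 t) (at t)"
proof (cases t "0::real" rule: linorder_cases)
  case less
  then have "\<forall>\<^sub>F x in nhds t. (max 0 x)\<^sup>2 = (0::real)"
    using eventually_nhds_in_open[of "{..<0}" t] by (auto elim!: eventually_mono)
  from DERIV_cong_ev[OF refl this refl] less show ?thesis by simp
next
  case equal
  have "((\<lambda>h. (max 0 h)\<^sup>2 / h) \<longlongrightarrow> (0::real)) (at 0)"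
  proof (rule Lim_null_comparison[where g = "\<lambda>h. \<bar>h\<bar>"])
    show "\<forall>\<^sub>F h in at 0. norm ((max 0 h)\<^sup>2 / h) \<le> \<bar>h::real\<bar>"
      by (auto simp: eventually_at_filter max_def power2_eq_square)
    show "((\<lambda>h::real. \<bar>h\<bar>) \<longlongrightarrow> 0) (at 0)"
      by (rule tendsto_rabs_zero) (rule tendsto_ident_at)
  qed
  then show ?thesis using equal by (simp add: DERIV_def)
next
  case greater
  then have "\<forall>\<^sub>F x in nhds t. (max 0 x)\<^sup>2 = x\<^sup>2"
    using eventually_nhds_in_open[of "{0<..}" t] by (auto elim!: eventually_mono)
  from DERIV_cong_ev[OF refl this refl] greater show ?thesis
    by (auto intro!: derivative_eq_intros)
qed

lemma DERIV_step: "(step has_real_derivative step_deriv t) (at t)"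
proof -
  have "((\<lambda>t. (max 0 (t - c))\<^sup>2) has_real_derivative 2 * max 0 (t - c)) (at t)" for c t :: real
    using DERIV_chain2[OF DERIV_max_0_square, of "\<lambda>t. t - c" 1 t]
    by (simp add: DERIV_diff[OF DERIV_ident DERIV_const, simplified])
  note d = this[of 0, simplified] this[of "1/2"] this[of 1]
  have "((\<lambda>t. 2 * (max 0 t)\<^sup>2 - 4 * (max 0 (t - 1/2))\<^sup>2 + 2 * (max 0 (t - 1))\<^sup>2) has_real_derivative
      2 * (2 * max 0 t) - 4 * (2 * max 0 (t - 1/2)) + 2 * (2 * max 0 (t - 1))) (at t)"
    by (intro DERIV_add DERIV_diff DERIV_cmult d)
  then show ?thesis by (simp add: step_def [abs_def] step_deriv_def)
qed

lemma step_deriv_nonneg: "0 \<le> step_deriv t"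
  and step_deriv_le: "step_deriv t \<le> 2"
  and step_deriv_0 [simp]: "t \<le> 0 \<Longrightarrow> step_deriv t = 0"
  and step_deriv_ge: "1/4 \<le> t \<Longrightarrow> t \<le> 3/4 \<Longrightarrow> 1 \<le> step_deriv t"
  by (auto simp: step_deriv_def max_def)

lemma step_deriv_lipschitz: "\<bar>step_deriv s - step_deriv t\<bar> \<le> 4 * \<bar>s - t\<bar>"
  unfolding step_deriv_def max_def by (auto split: if_splits simp: abs_if)

lemma step_eq_0 [simp]: "t \<le> 0 \<Longrightarrow> step t = 0"
  and step_eq_1 [simp]: "1 \<le> t \<Longrightarrow> step t = 1"
  by (auto simp: step_def max_def power2_eq_square algebra_simps)

lemma step_mono: "s \<le> t \<Longrightarrow> step s \<le> step t"
  by (rule DERIV_nonneg_imp_nondecreasing) (use DERIV_step step_deriv_nonneg in blast)+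

lemma step_nonneg: "0 \<le> step t" and step_le_1: "step t \<le> 1"
  using step_mono[of "min 0 t" t] step_mono[of t "max 1 t"] by auto

lemma abs_step_le: "\<bar>step t\<bar> \<le> 1" and abs_step_deriv_le: "\<bar>step_deriv t\<bar> \<le> 2"
  by (simp_all add: step_nonneg step_le_1 step_deriv_nonneg step_deriv_le)

lemma step_lipschitz: "\<bar>step s - step t\<bar> \<le> 2 * \<bar>s - t\<bar>"
proof -
  have "norm (step s - step t) \<le> 2 * norm (s - t)"
    by (rule field_differentiable_bound[of UNIV step step_deriv])
      (auto simp: DERIV_step step_deriv_le step_deriv_nonneg)
  then show ?thesis by simp
qed

text \<open>
  The quadratic penalty for negative \<open>u\<close> replaces the usual two-sided construction: it makes the
  partial derivative in \<open>u\<close> negative for every \<open>u < 1\<close> once \<open>v \<ge> 1\<close>, while keeping both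
  partial derivatives nonpositive everywhere.
\<close>

definition link :: "real \<Rightarrow> real \<Rightarrow> real" where
  "link v u = (max 0 (- u))\<^sup>2 / 2 - step v * step (u / 4 + 1/2)"

definition link_v :: "real \<Rightarrow> real \<Rightarrow> real" where
  "link_v v u = - step_deriv v * step (u / 4 + 1/2)"

definition link_u :: "real \<Rightarrow> real \<Rightarrow> real" where
  "link_u v u = - max 0 (- u) - step v * step_deriv (u / 4 + 1/2) / 4"

lemma has_derivative_link:
  assumes "(p has_derivative p') (at z within S)" "(q has_derivative q') (at z within S)"
  shows "((\<lambda>x. link (p x) (q x)) has_derivative
    (\<lambda>h. link_v (p z) (q z) * p' h + link_u (p z) (q z) * q' h)) (at z within S)"
proof -
  note chain = has_derivative_compose[where g = step, OF _ DERIV_step[THEN has_field_derivative_imp_has_derivative]]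
  have "((\<lambda>x. step (p x)) has_derivative (\<lambda>h. step_deriv (p z) * p' h)) (at z within S)"
    by (rule chain) (rule assms)
  moreover have "((\<lambda>x. step (q x / 4 + 1/2)) has_derivative
      (\<lambda>h. step_deriv (q z / 4 + 1/2) * (q' h / 4))) (at z within S)"
    by (rule chain)
      (rule has_derivative_add_const bounded_linear.has_derivative[OF bounded_linear_divide] assms)+
  moreover have "((\<lambda>x. (max 0 (- q x))\<^sup>2) has_derivative
      (\<lambda>h. 2 * max 0 (- q z) * (- q' h))) (at z within S)"
    by (rule has_derivative_compose[where g = "\<lambda>t. (max 0 t)\<^sup>2",
          OF _ DERIV_max_0_square[THEN has_field_derivative_imp_has_derivative]])
      (rule has_derivative_minus assms)+
  ultimately have "((\<lambda>x. (max 0 (- q x))\<^sup>2 / 2 - step (p x) * step (q x / 4 + 1/2)) has_derivative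
      (\<lambda>h. 2 * max 0 (- q z) * (- q' h) / 2 - (step (p z) * (step_deriv (q z / 4 + 1/2) * (q' h / 4))
        + step_deriv (p z) * p' h * step (q z / 4 + 1/2)))) (at z within S)"
    by (intro has_derivative_diff has_derivative_mult bounded_linear.has_derivative[OF bounded_linear_divide])
  then show ?thesis
    by (simp add: link_def link_v_def link_u_def algebra_simps)
qed

lemma link_v_nonpos: "link_v v u \<le> 0"
  by (simp add: link_v_def step_deriv_nonneg step_nonneg)

lemma link_u_nonpos: "link_u v u \<le> 0"
  using mult_nonneg_nonneg[OF step_nonneg step_deriv_nonneg, of v "u / 4 + 1/2"]
  by (auto simp: link_u_def)

text \<open>For \<open>u < -1\<close> the quadratic penalty alone has slope below -1. For
  \<open>-1 \<le> u < 1\<close> the argument \<open>u / 4 + 1/2\<close> lies where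
  \<open>step_deriv\<close> is at least 1, and \<open>step v = 1\<close>.\<close>

lemma link_u_le:
  assumes "1 \<le> v" "u < 1"
  shows "link_u v u \<le> - 1/4"
proof (cases "u < -1")
  case True
  then show ?thesis using assms step_deriv_nonneg[of "u / 4 + 1/2"] by (simp add: link_u_def)
next
  case False
  then show ?thesis using assms step_deriv_ge[of "u / 4 + 1/2"] by (simp add: link_u_def)
qed

lemma link_ge: "- 1 \<le> link v u"
  using mult_le_one[OF step_le_1 step_nonneg step_le_1, of v "u / 4 + 1/2"]
    zero_le_power2[of "max 0 (- u)"]
  unfolding link_def by linarith

lemma link_at_0_le: "link v 0 \<le> 0"
  using mult_nonneg_nonneg[OF step_nonneg step_nonneg, of v "1/2"] by (simp add: link_def)

lemma link_0_0 [simp]: "link 0 0 = 0" "link_v 0 0 = 0" "link_u 0 0 = 0"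
  by (simp_all add: link_def link_v_def link_u_def)

lemma abs_mult_diff_le:
  fixes a b c d :: real
  assumes "\<bar>a - c\<bar> \<le> x" "\<bar>b - d\<bar> \<le> y" "\<bar>b\<bar> \<le> B" "\<bar>c\<bar> \<le> C"
  shows "\<bar>a * b - c * d\<bar> \<le> x * B + C * y"
proof -
  have "a * b - c * d = (a - c) * b + c * (b - d)" by (simp add: algebra_simps)
  also have "\<bar>\<dots>\<bar> \<le> \<bar>a - c\<bar> * \<bar>b\<bar> + \<bar>c\<bar> * \<bar>b - d\<bar>"
    by (metis abs_mult abs_triangle_ineq)
  also have "\<dots> \<le> x * B + C * y"
    using assms by (intro add_mono mult_mono) auto
  finally show ?thesis .
qed

lemma link_v_lipschitz: "\<bar>link_v v u - link_v v' u'\<bar> \<le> 4 * \<bar>v - v'\<bar> + \<bar>u - u'\<bar>"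
proof -
  have quarter: "\<bar>u / 4 + 1/2 - (u' / 4 + 1/2)\<bar> = \<bar>u - u'\<bar> / 4" by (simp flip: diff_divide_distrib)
  have "\<bar>step_deriv v * step (u / 4 + 1/2) - step_deriv v' * step (u' / 4 + 1/2)\<bar>
      \<le> 4 * \<bar>v - v'\<bar> * 1 + 2 * (\<bar>u - u'\<bar> / 2)"
    using step_lipschitz[of "u / 4 + 1/2" "u' / 4 + 1/2", unfolded quarter]
    by (intro abs_mult_diff_le step_deriv_lipschitz abs_step_le abs_step_deriv_le) simp
  then show ?thesis by (simp add: link_v_def abs_minus_commute)
qed

lemma link_u_lipschitz: "\<bar>link_u v u - link_u v' u'\<bar> \<le> \<bar>u - u'\<bar> + (\<bar>v - v'\<bar> + \<bar>u - u'\<bar> / 4)"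
proof -
  have quarter: "\<bar>u / 4 + 1/2 - (u' / 4 + 1/2)\<bar> = \<bar>u - u'\<bar> / 4" by (simp flip: diff_divide_distrib)
  have "\<bar>step v * step_deriv (u / 4 + 1/2) - step v' * step_deriv (u' / 4 + 1/2)\<bar>
      \<le> 2 * \<bar>v - v'\<bar> * 2 + 1 * \<bar>u - u'\<bar>"
    using step_deriv_lipschitz[of "u / 4 + 1/2" "u' / 4 + 1/2", unfolded quarter]
    by (intro abs_mult_diff_le step_lipschitz abs_step_le abs_step_deriv_le) simp
  then have "\<bar>step v * step_deriv (u / 4 + 1/2) / 4 - step v' * step_deriv (u' / 4 + 1/2) / 4\<bar>
      \<le> \<bar>v - v'\<bar> + \<bar>u - u'\<bar> / 4"
    unfolding diff_divide_distrib[symmetric] abs_divide by simp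
  moreover have "\<bar>max 0 (- u) - max 0 (- u')\<bar> \<le> \<bar>u - u'\<bar>" by (auto simp: max_def)
  moreover have "\<bar>(- a - b) - (- a' - b')\<bar> \<le> \<bar>a - a'\<bar> + \<bar>b - b'\<bar>" for a b a' b' :: real
    by linarith
  ultimately show ?thesis
    unfolding link_u_def by (meson add_mono order_trans)
qed

subsection \<open>Moreau envelopes and the resisting oracle\<close>

text \<open>By Cauchy-Schwarz the supremum is attained on the ray through \<open>v\<close>. This
  turns the maximization over the dual ball into an exact norm penalty.\<close>

lemma SUP_inner_ball_Rn:
  assumes v: "v \<in> Rn n" and R: "0 \<le> R"
  shows "(SUP y\<in>{y \<in> Rn n. norm y \<le> R}. ereal (c + inner y v)) = ereal (c + R * norm v)"
proof (rule SUP_eqI)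
  fix y assume "y \<in> {y \<in> Rn n. norm y \<le> R}"
  then have "inner y v \<le> R * norm v"
    by (intro order_trans[OF norm_cauchy_schwarz] mult_right_mono) auto
  then show "ereal (c + inner y v) \<le> ereal (c + R * norm v)" by simp
next
  fix u assume u: "\<And>y. y \<in> {y \<in> Rn n. norm y \<le> R} \<Longrightarrow> ereal (c + inner y v) \<le> u"
  have "inner ((R / norm v) *\<^sub>R v) v = R * norm v"
    by (cases "v = 0") (auto simp: dot_square_norm power2_eq_square)
  moreover have "(R / norm v) *\<^sub>R v \<in> {y \<in> Rn n. norm y \<le> R}"
    using v R by (cases "v = 0") (auto simp: subspace_scale[OF subspace_Rn])
  ultimately show "ereal (c + R * norm v) \<le> u" using u by metis
qed

lemma gradient_eqI:
  assumes "convex S" "0 \<in> S" "z \<in> S" "has_gradient S f z g"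
  shows "gradient S f z = g"
  unfolding gradient_def using has_gradient_unique[OF assms(1-3)] assms(4) by blast

text \<open>Let \<open>z\<close> minimize the proximal objective at \<open>x\<close>. Freezing
  \<open>z\<close> gives a smooth majorant of the envelope that touches it at \<open>x\<close>, so
  both have the same derivative there along \<open>x - z\<close>. With \<open>g\<close> the gradient
  of the envelope, this reads
  \<open>2 * l * (norm (x - z))\<^sup>2 = inner g (x - z)\<close>.\<close>

lemma eps_OS_imp_near_prox_point:
  fixes \<phi> :: "fvec \<Rightarrow> real"
  assumes X: "setX d = Rn (dimX d)"
    and Phi: "\<And>z. z \<in> Rn (dimX d) \<Longrightarrow> Phi d f z = ereal (\<phi> z)"
    and cont: "continuous_on (Rn (dimX d)) \<phi>"
    and lower: "\<And>z. z \<in> Rn (dimX d) \<Longrightarrow> - C \<le> \<phi> z"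
    and l: "0 < l" and OS: "eps_OS l \<epsilon> d f x"
  obtains z where "z \<in> Rn (dimX d)" "2 * l * norm (x - z) \<le> \<epsilon>"
    "\<And>z'. z' \<in> Rn (dimX d) \<Longrightarrow> \<phi> z + l * (norm (x - z))\<^sup>2 \<le> \<phi> z' + l * (norm (x - z'))\<^sup>2"
proof -
  let ?V = "Rn (dimX d)"
  have x: "x \<in> ?V" using OS X by (simp add: eps_OS_def)
  define E where "E u = real_of_ereal (moreau_envelope l d f u)" for u
  obtain g where g: "has_gradient ?V E x g" "norm g \<le> \<epsilon>"
    using OS by (auto simp: eps_OS_def E_def [abs_def])
  define h where "h u z = \<phi> z + l * (norm (u - z))\<^sup>2" for u z
  have env: "moreau_envelope l d f u = (INF z\<in>?V. ereal (h u z))" for u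
    unfolding moreau_envelope_def by (rule INF_cong) (auto simp: Phi h_def)
  have "continuous_on ?V (h x)"
    unfolding h_def by (intro continuous_intros cont)
  \<comment> \<open>Beyond this radius the quadratic term exceeds \<open>h x 0 + C\<close>, which
    outweighs the lower bound \<open>- C\<close> of \<open>\<phi>\<close>.\<close>
  moreover have "h x 0 < h x z"
    if z: "z \<in> ?V" "norm z > norm x + 1 + (\<phi> 0 + C + l * (norm x)\<^sup>2) / l" for z
  proof -
    define Q where "Q = (\<phi> 0 + C + l * (norm x)\<^sup>2) / l"
    have "0 \<le> \<phi> 0 + C" using lower[of 0] by (simp add: subspace_0[OF subspace_Rn])
    then have Q: "0 \<le> Q" using l by (simp add: Q_def)
    have n: "1 + Q < norm (x - z)"
      using z(2) norm_triangle_ineq2[of z x] by (simp add: Q_def norm_minus_commute)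
    then have "norm (x - z) * 1 \<le> norm (x - z) * norm (x - z)"
      using Q by (intro mult_left_mono) auto
    then have "Q < (norm (x - z))\<^sup>2" using n by (simp add: power2_eq_square)
    then have "l * Q < l * (norm (x - z))\<^sup>2" using l by simp
    moreover have "l * Q = \<phi> 0 + C + l * (norm x)\<^sup>2" using l by (simp add: Q_def)
    ultimately show ?thesis using lower[OF z(1)] by (simp add: h_def)
  qed
  ultimately obtain z where z: "z \<in> ?V" "\<And>z'. z' \<in> ?V \<Longrightarrow> h x z \<le> h x z'"
    by (rule coercive_attains_min_Rn[of _ "h x"]) blast+
  have E_le: "E u \<le> h u z" for u
  proof -
    have "moreau_envelope l d f u \<le> ereal (h u z)"
      unfolding env by (rule INF_lower) (rule z(1))
    \<comment> \<open>This rules out the value minus infinity, which \<open>real_of_ereal\<close>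
      would send to 0.\<close>
    moreover have "ereal (- C) \<le> moreau_envelope l d f u"
      unfolding env using lower l by (intro INF_greatest) (simp add: h_def add_increasing2)
    ultimately show ?thesis
      unfolding E_def by (cases "moreau_envelope l d f u") auto
  qed
  have "moreau_envelope l d f x = ereal (h x z)"
    unfolding env by (rule INF_eqI) (use z in auto)
  then have E_x: "E x = h x z" by (simp add: E_def)
  define v where "v = x - z"
  have v: "v \<in> ?V" using x z(1) by (simp add: v_def subspace_diff[OF subspace_Rn])
  \<comment> \<open>The gap between majorant and envelope on the line through \<open>x\<close> in
    direction \<open>v\<close>: it vanishes at \<open>t = 0\<close> and is nonnegative.\<close>
  define q where "q t = h (x + t *\<^sub>R v) z - E (x + t *\<^sub>R v)" for t :: real
  have "((\<lambda>t. E (x + t *\<^sub>R v)) has_derivative (\<lambda>t. inner g (t *\<^sub>R v))) (at 0)"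
  proof -
    have "(E has_derivative inner g) (at (x + 0 *\<^sub>R v) within (\<lambda>t. x + t *\<^sub>R v) ` UNIV)"
      using g(1) x v
      by (auto simp: has_gradient_def intro: has_derivative_subset subspace_add subspace_scale subspace_Rn)
    moreover have "((\<lambda>t. x + t *\<^sub>R v) has_derivative (\<lambda>t. t *\<^sub>R v)) (at 0)"
      by (auto intro!: derivative_eq_intros)
    ultimately show ?thesis by (rule has_derivative_in_compose[rotated])
  qed
  then have "((\<lambda>t. E (x + t *\<^sub>R v)) has_real_derivative inner g v) (at 0)"
    by (simp add: has_field_derivative_def mult_commute_abs)
  moreover have "h (x + t *\<^sub>R v) z = \<phi> z + l * (1 + t)\<^sup>2 * (norm v)\<^sup>2" for t
  proof -
    have "x + t *\<^sub>R v - z = (1 + t) *\<^sub>R v" by (simp add: v_def algebra_simps)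
    then show ?thesis by (simp add: h_def power_mult_distrib)
  qed
  ultimately have "(q has_real_derivative 2 * l * (norm v)\<^sup>2 - inner g v) (at 0)"
    unfolding q_def [abs_def] by (auto intro!: derivative_eq_intros)
  moreover have "q 0 \<le> q t" for t
    using E_le E_x by (simp add: q_def)
  ultimately have "2 * l * (norm v)\<^sup>2 - inner g v = 0"
    by (blast intro: DERIV_local_min[OF _ zero_less_one])
  then have "2 * l * norm v * norm v \<le> \<epsilon> * norm v"
    using norm_cauchy_schwarz[of g v] mult_right_mono[OF g(2), of "norm v"]
    by (simp add: power2_eq_square)
  then have "2 * l * norm v \<le> \<epsilon>"
    by (cases "v = 0") (auto intro: order_trans[OF norm_ge_zero g(2)])
  then show thesis using that[of z] z by (simp add: v_def h_def)
qed

section \<open>Orthonormal families and the resisting oracle\<close>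

definition orthonormal_upto :: "nat \<Rightarrow> (nat \<Rightarrow> 'a::real_inner) \<Rightarrow> bool" where
  "orthonormal_upto k a \<longleftrightarrow> (\<forall>i<k. \<forall>j<k. inner (a i) (a j) = (if i = j then 1 else 0))"

text \<open>The zeros stand for directions not chosen yet, so a truncated objective is available
  before they are.\<close>

definition cut_family :: "nat \<Rightarrow> (nat \<Rightarrow> 'a::zero) \<Rightarrow> nat \<Rightarrow> 'a" where
  "cut_family s a q = (if q < s then a q else 0)"

lemma orthonormal_upto_Suc:
  assumes "orthonormal_upto k a" "norm u = 1" "\<And>i. i < k \<Longrightarrow> inner (a i) u = 0"
  shows "orthonormal_upto (Suc k) (a(k := u))"
  using assms by (auto simp: orthonormal_upto_def less_Suc_eq inner_commute dot_square_norm)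

lemma inner_combination:
  assumes "orthonormal_upto n a" "p < n"
  shows "inner (a p) (\<Sum>q<n. \<kappa> q *\<^sub>R a q) = \<kappa> p"
proof -
  have "inner (a p) (\<Sum>q<n. \<kappa> q *\<^sub>R a q) = (\<Sum>q<n. if q = p then \<kappa> q else 0)"
    unfolding inner_sum_right using assms
    by (intro sum.cong) (auto simp: orthonormal_upto_def)
  then show ?thesis using assms(2) by simp
qed

text \<open>
  The direction with index \<open>t\<close> is fixed only after the \<open>t\<close>-th query is known, orthogonally to all
  queries so far. Up to that query the algorithm cannot distinguish the final function from the
  one in which all directions from index \<open>t\<close> on are replaced by zero.
\<close>

lemma resisting_oracle:
  fixes F :: "(nat \<Rightarrow> fvec) \<Rightarrow> (nat \<Rightarrow> fvec) \<Rightarrow> objective"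
  assumes A: "A \<in> A_det" and d: "admissible_domain d"
    and dims: "2 * P \<le> dimX d" "2 * P \<le> dimY d"
    and diff: "\<And>a b. range a \<subseteq> Rn (dimX d) \<Longrightarrow> range b \<subseteq> Rn (dimY d) \<Longrightarrow>
      differentiable_obj d (F a b)"
    and local: "\<And>a b a' b' z s.
      \<lbrakk>range a \<subseteq> Rn (dimX d); range b \<subseteq> Rn (dimY d);
       range a' \<subseteq> Rn (dimX d); range b' \<subseteq> Rn (dimY d); z \<in> dom_XY d;
       \<And>q. q \<le> s \<Longrightarrow> a q = a' q \<and> b q = b' q;
       \<And>q. s \<le> q \<Longrightarrow> inner (a q) (fst z) = 0 \<and> inner (a' q) (fst z) = 0 \<and>
         inner (b q) (snd z) = 0 \<and> inner (b' q) (snd z) = 0\<rbrakk> \<Longrightarrow>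
      oracle_answer d (F a b) z = oracle_answer d (F a' b') z"
  obtains a b where "range a \<subseteq> Rn (dimX d)" "range b \<subseteq> Rn (dimY d)"
    "orthonormal_upto P a" "orthonormal_upto P b"
    "\<And>s p. s \<le> p \<Longrightarrow> p < P \<Longrightarrow> inner (a p) (fst (A d (F a b) s)) = 0"
proof -
  let ?X = "Rn (dimX d)" and ?Y = "Rn (dimY d)"
  let ?c = cut_family
  have query_in: "A d f t \<in> dom_XY d" if "differentiable_obj d f" for f t
    using A d that by (auto simp: A_det_def first_order_algorithm_def)
  obtain \<Gamma> where \<Gamma>: "\<And>f. differentiable_obj d f \<Longrightarrow> A d f 0 = (0, 0)"
      "\<And>f t. differentiable_obj d f \<Longrightarrow> t \<ge> 1 \<Longrightarrow>
        A d f t = \<Gamma> t d (map (\<lambda>s. oracle_answer d f (A d f s)) [0..<t])"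
    using A d by (auto simp: A_det_def)
  have cut_range: "range (?c s a) \<subseteq> Rn m" if "range a \<subseteq> Rn m" for s a m
    using that by (auto simp: cut_family_def subspace_0[OF subspace_Rn])
  \<comment> \<open>Query \<open>s\<close> is computed on the objective truncated at
    \<open>s\<close>, hence depends only on directions with index below \<open>s\<close>.\<close>
  define q where "q s a b = A d (F (?c s a) (?c s b)) s" for s a b
  define Q where "Q k a b \<longleftrightarrow> range a \<subseteq> ?X \<and> range b \<subseteq> ?Y \<and>
      orthonormal_upto k a \<and> orthonormal_upto k b \<and>
      (\<forall>p<k. \<forall>s\<le>p. inner (a p) (fst (q s a b)) = 0 \<and> inner (b p) (snd (q s a b)) = 0)" for k a b
  have "\<exists>a b. Q k a b" if "k \<le> P" for k
    using that
  proof (induction k)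
    case 0
    have "Q 0 (\<lambda>_. 0) (\<lambda>_. 0)"
      by (auto simp: Q_def orthonormal_upto_def subspace_0[OF subspace_Rn])
    then show ?case by blast
  next
    case (Suc k)
    then obtain a b where ab: "Q k a b" by auto
    \<comment> \<open>The new direction has to be orthogonal to the \<open>k\<close> earlier
      directions and to the queries 0 to \<open>k\<close>, which makes \<open>2 * k + 1\<close>
      conditions.\<close>
    have lt: "2 * k + 1 < dimX d" "2 * k + 1 < dimY d" using Suc.prems dims by auto
    obtain u where u: "u \<in> ?X" "norm u = 1" "\<And>i. i < 2 * k + 1 \<Longrightarrow>
        inner (if i < k then a i else fst (q (i - k) a b)) u = 0"
      using unit_vector_orthogonal_exists[OF lt(1),
          of "\<lambda>i. if i < k then a i else fst (q (i - k) a b)"] by blast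
    obtain v where v: "v \<in> ?Y" "norm v = 1" "\<And>i. i < 2 * k + 1 \<Longrightarrow>
        inner (if i < k then b i else snd (q (i - k) a b)) v = 0"
      using unit_vector_orthogonal_exists[OF lt(2),
          of "\<lambda>i. if i < k then b i else snd (q (i - k) a b)"] by blast
    have u_a: "inner (a i) u = 0" and v_b: "inner (b i) v = 0" if "i < k" for i
      using u(3)[of i] v(3)[of i] that by auto
    have u_q: "inner u (fst (q s a b)) = 0" and v_q: "inner v (snd (q s a b)) = 0" if "s \<le> k" for s
      using u(3)[of "s + k"] v(3)[of "s + k"] that by (auto simp: inner_commute)
    have "?c s (f(k := w)) = ?c s f" if "s \<le> k" for s w and f :: "nat \<Rightarrow> fvec"
      using that by (auto simp: cut_family_def fun_eq_iff)
    then have q_upd: "q s (a(k := u)) (b(k := v)) = q s a b" if "s \<le> k" for s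
      using that by (simp add: q_def)
    have "Q (Suc k) (a(k := u)) (b(k := v))"
      using ab u(1,2) v(1,2) u_a v_b u_q v_q
      by (auto simp: Q_def less_Suc_eq q_upd intro!: orthonormal_upto_Suc)
    then show ?case by blast
  qed
  then obtain a b where ab: "Q P a b" by blast
  then have rng: "range a \<subseteq> ?X" "range b \<subseteq> ?Y" by (auto simp: Q_def)
  let ?F = "\<lambda>t. F (?c t a) (?c t b)"
  have diff_F: "differentiable_obj d (?F t)" for t
    using diff cut_range rng by blast
  \<comment> \<open>Truncating later does not change the first queries. By induction the earlier
    queries coincide; at query \<open>s'\<close> the two truncations agree up to index
    \<open>s'\<close>, and all entries from there on are orthogonal to the query, so
    \<open>local\<close> applies.\<close>
  have same: "A d (?F t) s = q s a b" if "s \<le> t" "t \<le> P" for s t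
    using that
  proof (induction s arbitrary: t rule: less_induct)
    case (less s)
    show ?case
    proof (cases "s = 0")
      case True
      then show ?thesis using \<Gamma>(1) diff_F by (simp add: q_def)
    next
      case False
      have "oracle_answer d (?F t) (A d (?F t) s') = oracle_answer d (?F s) (A d (?F s) s')"
        if s': "s' < s" for s'
      proof -
        have eq: "A d (?F t) s' = q s' a b" "A d (?F s) s' = q s' a b"
          using less s' by auto
        have "inner (?c k a p) (fst (q s' a b)) = 0 \<and> inner (?c k b p) (snd (q s' a b)) = 0"
          if "s' \<le> p" "k \<le> P" for p k
          using ab that by (auto simp: Q_def cut_family_def)
        then have "oracle_answer d (?F t) (q s' a b) = oracle_answer d (?F s) (q s' a b)"
          using query_in[OF diff_F, of s' s'] less.prems s'
          by (intro local[where s = s'] cut_range rng) (auto simp: q_def cut_family_def)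
        then show ?thesis by (simp add: eq)
      qed
      then have "map (\<lambda>s'. oracle_answer d (?F t) (A d (?F t) s')) [0..<s] =
          map (\<lambda>s'. oracle_answer d (?F s) (A d (?F s) s')) [0..<s]"
        by simp
      moreover have "s \<ge> 1" using False by simp
      ultimately have "A d (?F t) s = A d (?F s) s"
        by (simp only: \<Gamma>(2)[OF diff_F[of t], of s] \<Gamma>(2)[OF diff_F[of s], of s])
      then show ?thesis by (simp add: q_def)
    qed
  qed
  \<comment> \<open>The final families are cut at \<open>P\<close>, so \<open>same\<close> with
    \<open>t = P\<close> covers every query \<open>s < P\<close>.\<close>
  have "inner (?c P a p) (fst (A d (?F P) s)) = 0" if "s \<le> p" "p < P" for s p
    using ab that same[of s P] by (auto simp: Q_def cut_family_def)
  moreover have "orthonormal_upto P (?c P a)" "orthonormal_upto P (?c P b)"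
    using ab by (auto simp: Q_def orthonormal_upto_def cut_family_def)
  ultimately show thesis
    using that cut_range rng by blast
qed

subsection \<open>The hard instance\<close>

lemma L2_set_le_lincomb:
  assumes "\<And>p. p \<in> A \<Longrightarrow> \<bar>f p\<bar> \<le> \<alpha> * \<bar>g p\<bar> + \<beta> * \<bar>h p\<bar>" "0 \<le> \<alpha>" "0 \<le> \<beta>"
  shows "L2_set f A \<le> \<alpha> * L2_set g A + \<beta> * L2_set h A"
proof -
  have abs: "L2_set (\<lambda>p. \<bar>f p\<bar>) A = L2_set f A" for f :: "'a \<Rightarrow> real"
    by (simp add: L2_set_def)
  have "L2_set (\<lambda>p. \<bar>f p\<bar>) A \<le> L2_set (\<lambda>p. \<alpha> * \<bar>g p\<bar> + \<beta> * \<bar>h p\<bar>) A"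
    using assms(1) by (intro L2_set_mono) auto
  also have "\<dots> \<le> L2_set (\<lambda>p. \<alpha> * \<bar>g p\<bar>) A + L2_set (\<lambda>p. \<beta> * \<bar>h p\<bar>) A"
    by (rule L2_set_triangle_ineq)
  also have "\<dots> = \<alpha> * L2_set g A + \<beta> * L2_set h A"
    using assms(2,3) by (simp add: abs flip: L2_set_right_distrib)
  finally show ?thesis by (simp add: abs)
qed

text \<open>Allowing norms below 1 admits the zero vector \<open>prev a 0\<close> in an otherwise
  orthonormal family.\<close>

definition suborthonormal :: "'i set \<Rightarrow> ('i \<Rightarrow> 'a::real_inner) \<Rightarrow> bool" where
  "suborthonormal A g \<longleftrightarrow> finite A \<and> (\<forall>i\<in>A. inner (g i) (g i) \<le> 1) \<and>
     (\<forall>i\<in>A. \<forall>j\<in>A. i \<noteq> j \<longrightarrow> inner (g i) (g j) = 0)"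

lemma norm_sum_suborthonormal:
  assumes "suborthonormal A g"
  shows "norm (\<Sum>i\<in>A. c i *\<^sub>R g i) \<le> L2_set c A"
proof -
  have fin: "finite A" using assms by (simp add: suborthonormal_def)
  have "(norm (\<Sum>i\<in>A. c i *\<^sub>R g i))\<^sup>2 = (\<Sum>i\<in>A. \<Sum>j\<in>A. c i * c j * inner (g i) (g j))"
    by (simp add: power2_norm_eq_inner inner_sum_left inner_sum_right algebra_simps
        inner_commute)
  also have "\<dots> = (\<Sum>i\<in>A. (c i)\<^sup>2 * inner (g i) (g i))"
  proof (rule sum.cong)
    fix i assume i: "i \<in> A"
    have "(\<Sum>j\<in>A. c i * c j * inner (g i) (g j)) = (\<Sum>j\<in>{i}. c i * c j * inner (g i) (g j))"
      using fin i assms by (intro sum.mono_neutral_right) (auto simp: suborthonormal_def)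
    then show "(\<Sum>j\<in>A. c i * c j * inner (g i) (g j)) = (c i)\<^sup>2 * inner (g i) (g i)"
      by (simp add: power2_eq_square)
  qed simp
  also have "\<dots> \<le> (\<Sum>i\<in>A. (c i)\<^sup>2)"
    using assms by (intro sum_mono) (auto simp: suborthonormal_def intro: mult_left_le)
  finally show ?thesis
    unfolding L2_set_def by (rule real_le_rsqrt)
qed

text \<open>Bessel's inequality by duality: the squared left side is the inner product of
  \<open>x\<close> with a combination whose norm the preceding lemma bounds.\<close>

lemma bessel_suborthonormal:
  assumes "suborthonormal A g"
  shows "L2_set (\<lambda>i. inner (g i) x) A \<le> norm x"
proof -
  let ?L = "L2_set (\<lambda>i. inner (g i) x) A"
  have "?L\<^sup>2 = inner (\<Sum>i\<in>A. inner (g i) x *\<^sub>R g i) x"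
    by (simp add: L2_set_def sum_nonneg inner_sum_left power2_eq_square)
  also have "\<dots> \<le> ?L * norm x"
    by (intro order_trans[OF norm_cauchy_schwarz] mult_right_mono norm_sum_suborthonormal assms) simp
  finally show ?thesis
    by (cases "?L = 0") (auto simp: power2_eq_square mult_le_cancel_left less_le)
qed

section \<open>The domain: a primal space times a dual ball\<close>

definition ball_domain :: "nat \<Rightarrow> nat \<Rightarrow> real \<Rightarrow> saddle_domain" where
  "ball_domain m n R = \<lparr>dimX = m, dimY = n, setX = Rn m, setY = {y \<in> Rn n. norm y \<le> R}\<rparr>"

lemma ball_domain_sel [simp]:
  "dimX (ball_domain m n R) = m" "dimY (ball_domain m n R) = n"
  "setX (ball_domain m n R) = Rn m" "setY (ball_domain m n R) = {y \<in> Rn n. norm y \<le> R}"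
  by (simp_all add: ball_domain_def)

lemma ball_Rn_eq: "{y \<in> Rn n. norm y \<le> R} = Rn n \<inter> cball 0 R"
  by auto

lemma admissible_ball_domain:
  assumes "0 \<le> R"
  shows "admissible_domain (ball_domain m n R)"
  using assms
  by (auto simp: admissible_domain_def dom_XY_def closed_Rn ball_Rn_eq closed_Int convex_Int
      subspace_imp_convex subspace_Rn subspace_0)

lemma bounded_ball_domain: "bounded (setY (ball_domain m n R))"
  by (simp add: ball_Rn_eq bounded_Int)

lemma diameter_ball_domain:
  assumes "0 \<le> R"
  shows "diameter (setY (ball_domain m n R)) \<le> 2 * R"
proof (rule diameter_le)
  fix x y assume "x \<in> setY (ball_domain m n R)" "y \<in> setY (ball_domain m n R)"
  then show "norm (x - y) \<le> 2 * R" using norm_triangle_ineq4[of x y] by simp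
qed (use assms in simp)

lemma dom_ball_domain:
  assumes "0 \<le> R"
  shows "convex (dom_XY (ball_domain m n R))" "0 \<in> dom_XY (ball_domain m n R)"
  using admissible_ball_domain[OF assms]
  by (simp_all add: admissible_domain_def dom_XY_def convex_Times zero_prod_def)

text \<open>Gradients must lie in the span of the domain. A ball of positive radius spans its whole
  space by rescaling, so every pair of vectors is allowed.\<close>

lemma Rn_Times_subset_span_dom:
  assumes "0 < R" "x \<in> Rn m" "y \<in> Rn n"
  shows "(x, y) \<in> span (dom_XY (ball_domain m n R))"
proof -
  let ?D = "dom_XY (ball_domain m n R)"
  have "(x, 0) \<in> span ?D"
    using assms by (intro span_base) (simp add: dom_XY_def subspace_0[OF subspace_Rn])
  moreover have "(0, y) \<in> span ?D"
  proof (cases "y = 0")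
    case True
    then show ?thesis using span_0[of ?D] by (simp add: zero_prod_def)
  next
    case False
    have "(0, (R / norm y) *\<^sub>R y) \<in> ?D"
      using assms False
      by (simp add: dom_XY_def subspace_0[OF subspace_Rn] subspace_scale[OF subspace_Rn])
    then have "(norm y / R) *\<^sub>R (0, (R / norm y) *\<^sub>R y) \<in> span ?D"
      by (intro span_mul span_base)
    then show ?thesis using assms False by simp
  qed
  ultimately have "(x, 0) + (0, y) \<in> span ?D" by (rule span_add)
  then show ?thesis by simp
qed

locale hard_instance =
  fixes K T :: nat and l r :: real
  assumes K_pos: "0 < K" and l_pos: "0 < l" and r_pos: "0 < r"
begin

text \<open>
  Coordinates are indexed by \<open>p < T * (K + 1)\<close>, in \<open>T\<close> blocks of length \<open>K + 1\<close>. At the first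
  index of each block the function links the block nonconvexly to the preceding one; at the other
  indices the dual variable penalizes the (weighted) jump inside the block.
\<close>

definition heads :: "nat set" where
  "heads = {p. p < T * Suc K \<and> Suc K dvd p}"

definition rest :: "nat set" where
  "rest = {p. p < T * Suc K \<and> \<not> Suc K dvd p}"

text \<open>The small weight at both ends makes a jump-free shift of a block concentrate there: with
  end coordinates 1 the inner ones are \<open>1 / sqrt K\<close>, so the shift has norm at most
  \<open>sqrt 3\<close>, whatever \<open>K\<close> is.\<close>

definition wt :: "nat \<Rightarrow> real" where
  "wt p = (if Suc K dvd p \<or> Suc K dvd Suc p then 1 / sqrt K else 1)"

definition prev :: "(nat \<Rightarrow> fvec) \<Rightarrow> nat \<Rightarrow> fvec" where
  "prev a p = (if p = 0 then 0 else a (p - 1))"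

definition edge :: "(nat \<Rightarrow> fvec) \<Rightarrow> nat \<Rightarrow> fvec" where
  "edge a p = wt (p - 1) *\<^sub>R a (p - 1) - wt p *\<^sub>R a p"

text \<open>The constant 1 at \<open>p = 0\<close> switches the first link on. It does not depend on
  \<open>x\<close>, so the matching direction \<open>prev a 0\<close> is zero.\<close>

definition tl_coord :: "(nat \<Rightarrow> fvec) \<Rightarrow> fvec \<Rightarrow> nat \<Rightarrow> real" where
  "tl_coord a x p = (if p = 0 then 1 else inner (a (p - 1)) x / r)"

definition hd_coord :: "(nat \<Rightarrow> fvec) \<Rightarrow> fvec \<Rightarrow> nat \<Rightarrow> real" where
  "hd_coord a x p = inner (a p) x / r"

text \<open>The factor makes the gradient \<open>l / 2\<close>-Lipschitz and limits the negative
  contribution of each block to \<open>l * r\<^sup>2 / 16\<close>.\<close>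

definition pot :: "(nat \<Rightarrow> fvec) \<Rightarrow> fvec \<Rightarrow> real" where
  "pot a x = l * r\<^sup>2 / 16 * (\<Sum>p\<in>heads. link (tl_coord a x p) (hd_coord a x p))"

definition pot_grad :: "(nat \<Rightarrow> fvec) \<Rightarrow> fvec \<Rightarrow> fvec" where
  "pot_grad a x = (l * r / 16) *\<^sub>R
     ((\<Sum>p\<in>heads. link_v (tl_coord a x p) (hd_coord a x p) *\<^sub>R prev a p) +
      (\<Sum>p\<in>heads. link_u (tl_coord a x p) (hd_coord a x p) *\<^sub>R a p))"

definition coup :: "(nat \<Rightarrow> fvec) \<Rightarrow> (nat \<Rightarrow> fvec) \<Rightarrow> fvec \<Rightarrow> fvec" where
  "coup a b x = (\<Sum>p\<in>rest. inner (edge a p) x *\<^sub>R b p)"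

definition coup_adj :: "(nat \<Rightarrow> fvec) \<Rightarrow> (nat \<Rightarrow> fvec) \<Rightarrow> fvec \<Rightarrow> fvec" where
  "coup_adj a b y = (\<Sum>p\<in>rest. inner (b p) y *\<^sub>R edge a p)"

definition obj :: "(nat \<Rightarrow> fvec) \<Rightarrow> (nat \<Rightarrow> fvec) \<Rightarrow> objective" where
  "obj a b z = pot a (fst z) + l / 8 * inner (snd z) (coup a b (fst z))"

definition obj_grad :: "(nat \<Rightarrow> fvec) \<Rightarrow> (nat \<Rightarrow> fvec) \<Rightarrow> fvec \<times> fvec \<Rightarrow> fvec \<times> fvec" where
  "obj_grad a b z =
     (pot_grad a (fst z) + (l / 8) *\<^sub>R coup_adj a b (snd z), (l / 8) *\<^sub>R coup a b (fst z))"

lemma finite_heads [simp]: "finite heads" and finite_rest [simp]: "finite rest"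
  by (auto simp: heads_def rest_def)

lemma rest_pos: "p \<in> rest \<Longrightarrow> 0 < p"
  by (auto simp: rest_def intro!: Nat.gr0I)

lemma card_heads: "card heads = T"
proof -
  have "heads = (\<lambda>i. i * Suc K) ` {..<T}"
  proof (intro equalityI subsetI)
    fix p assume "p \<in> heads"
    then obtain i where "p = i * Suc K" "i * Suc K < T * Suc K"
      unfolding heads_def by (metis (mono_tags, lifting) dvd_div_mult_self mem_Collect_eq)
    then show "p \<in> (\<lambda>i. i * Suc K) ` {..<T}"
      by (metis image_eqI lessThan_iff mult_less_cancel2)
  next
    fix p assume "p \<in> (\<lambda>i. i * Suc K) ` {..<T}"
    then obtain i where "i < T" "p = i * Suc K" by blast
    then show "p \<in> heads"
      unfolding heads_def by (simp only: mem_Collect_eq mult_less_cancel2 dvd_triv_right) simp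
  qed
  moreover have "inj_on (\<lambda>i. i * Suc K) {..<T}"
    by (auto simp: inj_on_def simp del: mult_Suc_right)
  ultimately show ?thesis by (simp add: card_image)
qed

lemma inner_coup_adj: "inner (coup_adj a b y) x = inner y (coup a b x)"
  by (simp add: coup_adj_def coup_def inner_sum_left inner_sum_right inner_commute mult.commute)

lemma linear_coup: "linear (coup a b)"
  by (rule linearI)
    (auto simp: coup_def inner_add_right scaleR_add_left sum.distrib scaleR_sum_right)

lemma bounded_linear_coup: "bounded_linear (coup a b)"
  unfolding coup_def
  by (intro bounded_linear_sum bounded_linear_scaleR_left[THEN bounded_linear_compose]
      bounded_linear_inner_right)

lemma linear_coup_adj: "linear (coup_adj a b)"
  by (rule linearI)
    (auto simp: coup_adj_def inner_add_right scaleR_add_left sum.distrib scaleR_sum_right)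

section \<open>Gradient and oracle answers\<close>

lemma has_derivative_pot:
  "(pot a has_derivative inner (pot_grad a x)) (at x within S)"
proof -
  have "((\<lambda>x. tl_coord a x p) has_derivative (\<lambda>h. inner (prev a p) h / r)) (at x within S)" for p
    using r_pos by (cases "p = 0") (auto simp: tl_coord_def prev_def intro!: derivative_eq_intros)
  moreover have "((\<lambda>x. hd_coord a x p) has_derivative (\<lambda>h. inner (a p) h / r)) (at x within S)" for p
    using r_pos by (auto simp: hd_coord_def intro!: derivative_eq_intros)
  ultimately have "(pot a has_derivative (\<lambda>h. l * r\<^sup>2 / 16 * (\<Sum>p\<in>heads.
      link_v (tl_coord a x p) (hd_coord a x p) * (inner (prev a p) h / r) +
      link_u (tl_coord a x p) (hd_coord a x p) * (inner (a p) h / r)))) (at x within S)"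
    unfolding pot_def [abs_def]
    by (intro has_derivative_mult_right has_derivative_sum has_derivative_link)
  then show ?thesis
    by (rule has_derivative_eq_rhs)
      (use r_pos in \<open>simp add: fun_eq_iff pot_grad_def inner_add_left inner_sum_left sum.distrib
        power2_eq_square distrib_left sum_divide_distrib[symmetric]\<close>)
qed

lemma has_derivative_obj:
  "(obj a b has_derivative inner (obj_grad a b z)) (at z within S)"
proof -
  have "((\<lambda>z. pot a (fst z)) has_derivative (\<lambda>h. inner (pot_grad a (fst z)) (fst h))) (at z within S)"
    by (rule has_derivative_compose[OF has_derivative_fst[OF has_derivative_ident] has_derivative_pot])
  moreover have "((\<lambda>z. inner (snd z) (coup a b (fst z))) has_derivative
      (\<lambda>h. inner (snd z) (coup a b (fst h)) + inner (snd h) (coup a b (fst z)))) (at z within S)"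
    by (intro has_derivative_inner has_derivative_snd has_derivative_ident
        bounded_linear.has_derivative[OF bounded_linear_coup] has_derivative_fst)
  ultimately have "(obj a b has_derivative (\<lambda>h. inner (pot_grad a (fst z)) (fst h) +
      l / 8 * (inner (snd z) (coup a b (fst h)) + inner (snd h) (coup a b (fst z))))) (at z within S)"
    unfolding obj_def [abs_def] by (intro has_derivative_add has_derivative_mult_right)
  then show ?thesis
    by (rule has_derivative_eq_rhs)
      (simp add: fun_eq_iff obj_grad_def inner_prod_def inner_add_left inner_coup_adj
        inner_commute[of "coup a b (fst z)"] algebra_simps)
qed

lemma prev_in_Rn: "range a \<subseteq> Rn m \<Longrightarrow> prev a p \<in> Rn m"
  by (auto simp: prev_def subspace_0[OF subspace_Rn])

lemma edge_in_Rn: "range a \<subseteq> Rn m \<Longrightarrow> edge a p \<in> Rn m"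
  by (auto simp: edge_def intro!: subspace_diff subspace_scale subspace_Rn)

lemma coup_in_Rn: "range b \<subseteq> Rn n \<Longrightarrow> coup a b x \<in> Rn n"
  by (auto simp: coup_def intro!: subspace_sum subspace_scale subspace_Rn)

lemma has_gradient_obj:
  assumes "range a \<subseteq> Rn m" "range b \<subseteq> Rn n" "0 < R"
  shows "has_gradient (dom_XY (ball_domain m n R)) (obj a b) z (obj_grad a b z)"
proof -
  have "pot_grad a (fst z) + (l / 8) *\<^sub>R coup_adj a b (snd z) \<in> Rn m"
    unfolding pot_grad_def coup_adj_def
    using assms(1) prev_in_Rn[OF assms(1)] edge_in_Rn[OF assms(1)]
    by (intro subspace_add subspace_scale subspace_sum subspace_Rn) auto
  then have "obj_grad a b z \<in> span (dom_XY (ball_domain m n R))"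
    unfolding obj_grad_def
    by (intro Rn_Times_subset_span_dom assms subspace_scale[OF subspace_Rn] coup_in_Rn)
  then show ?thesis by (simp add: has_gradient_def has_derivative_obj)
qed

lemma gradient_obj:
  assumes "range a \<subseteq> Rn m" "range b \<subseteq> Rn n" "0 < R" "z \<in> dom_XY (ball_domain m n R)"
  shows "gradient (dom_XY (ball_domain m n R)) (obj a b) z = obj_grad a b z"
  using assms by (intro gradient_eqI dom_ball_domain has_gradient_obj) auto

lemma differentiable_obj_obj:
  assumes "range a \<subseteq> Rn m" "range b \<subseteq> Rn n" "0 < R"
  shows "differentiable_obj (ball_domain m n R) (obj a b)"
  unfolding differentiable_obj_def using has_gradient_obj[OF assms] by blast

text \<open>Terms with index \<open>p \<le> s\<close> involve only directions on which the families
  agree. For \<open>p > s\<close> orthogonality makes both arguments of \<open>link\<close> and the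
  products with \<open>edge\<close> and \<open>b p\<close> zero, and the partial derivatives of
  \<open>link\<close> vanish at the origin. So no direction beyond index \<open>s\<close> shows up
  in the answer.\<close>

lemma oracle_answer_local:
  assumes rng: "range a \<subseteq> Rn m" "range b \<subseteq> Rn n" "range a' \<subseteq> Rn m" "range b' \<subseteq> Rn n"
    and R: "0 < R" and z: "z \<in> dom_XY (ball_domain m n R)"
    and eq: "\<And>q. q \<le> s \<Longrightarrow> a q = a' q \<and> b q = b' q"
    and orth: "\<And>q. s \<le> q \<Longrightarrow> inner (a q) (fst z) = 0 \<and> inner (a' q) (fst z) = 0 \<and>
      inner (b q) (snd z) = 0 \<and> inner (b' q) (snd z) = 0"
  shows "oracle_answer (ball_domain m n R) (obj a b) z = oracle_answer (ball_domain m n R) (obj a' b') z"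
proof -
  define x y where "x = fst z" and "y = snd z"
  have far: "tl_coord c x p = 0" "hd_coord c x p = 0" "inner (edge c p) x = 0"
    if "s < p" "c = a \<or> c = a'" for p c
    using that orth[of p] orth[of "p - 1"]
    by (auto simp: tl_coord_def hd_coord_def edge_def x_def inner_diff_left)
  have near: "tl_coord a x p = tl_coord a' x p" "hd_coord a x p = hd_coord a' x p"
    "prev a p = prev a' p" "edge a p = edge a' p" if "p \<le> s" for p
    using that eq[of p] eq[of "p - 1"] by (auto simp: tl_coord_def hd_coord_def edge_def prev_def)
  have "pot a x = pot a' x"
    unfolding pot_def using far near by (intro arg_cong2[where f = "(*)"] sum.cong refl) (metis not_le)
  moreover have "pot_grad a x = pot_grad a' x"
  proof -
    have "link_v (tl_coord a x p) (hd_coord a x p) *\<^sub>R prev a p =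
        link_v (tl_coord a' x p) (hd_coord a' x p) *\<^sub>R prev a' p \<and>
      link_u (tl_coord a x p) (hd_coord a x p) *\<^sub>R a p =
        link_u (tl_coord a' x p) (hd_coord a' x p) *\<^sub>R a' p" for p
      using far[of p] near[of p] eq[of p] by (cases "p \<le> s") auto
    then show ?thesis by (simp add: pot_grad_def)
  qed
  moreover have "coup a b x = coup a' b' x"
  proof -
    have "inner (edge a p) x *\<^sub>R b p = inner (edge a' p) x *\<^sub>R b' p" for p
      using far[of p] near[of p] eq[of p] by (cases "p \<le> s") auto
    then show ?thesis by (simp add: coup_def)
  qed
  moreover have "coup_adj a b y = coup_adj a' b' y"
  proof -
    have "inner (b p) y *\<^sub>R edge a p = inner (b' p) y *\<^sub>R edge a' p" for p
      using near[of p] eq[of p] orth[of p] by (cases "p \<le> s") (auto simp: y_def)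
    then show ?thesis by (simp add: coup_adj_def)
  qed
  ultimately have "obj a b z = obj a' b' z" "obj_grad a b z = obj_grad a' b' z"
    by (simp_all add: obj_def obj_grad_def x_def y_def)
  then show ?thesis
    using rng R z by (simp add: oracle_answer_def gradient_obj)
qed

section \<open>Smoothness\<close>

lemma suborthonormal_family:
  assumes "orthonormal_upto (T * Suc K) a"
  shows "suborthonormal heads a" "suborthonormal heads (prev a)"
    "suborthonormal rest a" "suborthonormal rest (prev a)" "suborthonormal {..<T * Suc K} a"
proof -
  have "suborthonormal A a \<and> suborthonormal A (prev a)" if "A \<subseteq> {..<T * Suc K}" for A
  proof -
    have "finite A" using that finite_subset by blast
    moreover have "i < T * Suc K \<and> i - 1 < T * Suc K" if "i \<in> A" for i
      using \<open>A \<subseteq> {..<T * Suc K}\<close> that by auto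
    ultimately show ?thesis
      using assms by (auto simp: suborthonormal_def prev_def orthonormal_upto_def simp del: mult_Suc_right)
  qed
  from this[of heads] this[of rest] this[of "{..<T * Suc K}"]
  show "suborthonormal heads a" "suborthonormal heads (prev a)"
    "suborthonormal rest a" "suborthonormal rest (prev a)" "suborthonormal {..<T * Suc K} a"
    by (auto simp: heads_def rest_def)
qed

lemma wt_bounds: "0 < wt p" "wt p \<le> 1"
  using K_pos by (auto simp: wt_def)

text \<open>The edges on \<open>rest\<close> are differences of two suborthonormal families with
  weights at most 1; each family contributes one \<open>norm x\<close> by Bessel's
  inequality.\<close>

lemma norm_coup_le:
  assumes "orthonormal_upto (T * Suc K) a" "orthonormal_upto (T * Suc K) b"
  shows "norm (coup a b x) \<le> 2 * norm x"
proof -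
  have "norm (coup a b x) \<le> L2_set (\<lambda>p. inner (edge a p) x) rest"
    unfolding coup_def by (intro norm_sum_suborthonormal suborthonormal_family assms)
  also have "\<dots> \<le> 1 * L2_set (\<lambda>p. inner (prev a p) x) rest + 1 * L2_set (\<lambda>p. inner (a p) x) rest"
  proof (rule L2_set_le_lincomb)
    fix p assume "p \<in> rest"
    then have "inner (edge a p) x = wt (p - 1) * inner (prev a p) x - wt p * inner (a p) x"
      using rest_pos[of p] by (simp add: edge_def prev_def inner_diff_left)
    also have "\<bar>\<dots>\<bar> \<le> wt (p - 1) * \<bar>inner (prev a p) x\<bar> + wt p * \<bar>inner (a p) x\<bar>"
      using wt_bounds[of p] wt_bounds[of "p - 1"]
      by (intro order_trans[OF abs_triangle_ineq4]) (simp add: abs_mult)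
    also have "\<dots> \<le> 1 * \<bar>inner (prev a p) x\<bar> + 1 * \<bar>inner (a p) x\<bar>"
      using wt_bounds by (intro add_mono mult_right_mono) auto
    finally show "\<bar>inner (edge a p) x\<bar> \<le> 1 * \<bar>inner (prev a p) x\<bar> + 1 * \<bar>inner (a p) x\<bar>" .
  qed auto
  also have "\<dots> \<le> 1 * norm x + 1 * norm x"
    by (intro add_mono mult_left_mono bessel_suborthonormal suborthonormal_family assms) auto
  finally show ?thesis by simp
qed

text \<open>The adjoint inherits the bound, by pairing its value with itself.\<close>

lemma norm_coup_adj_le:
  assumes "orthonormal_upto (T * Suc K) a" "orthonormal_upto (T * Suc K) b"
  shows "norm (coup_adj a b y) \<le> 2 * norm y"
proof -
  let ?v = "coup_adj a b y"
  have "(norm ?v)\<^sup>2 = inner y (coup a b ?v)"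
    by (simp add: power2_norm_eq_inner inner_coup_adj)
  also have "\<dots> \<le> norm y * (2 * norm ?v)"
    by (intro order_trans[OF norm_cauchy_schwarz] mult_left_mono norm_coup_le assms) simp
  finally have "norm ?v * norm ?v \<le> (2 * norm y) * norm ?v"
    by (simp add: power2_eq_square mult_ac)
  then show ?thesis by (cases "?v = 0") auto
qed

lemma norm_pot_grad_diff_le:
  assumes "orthonormal_upto (T * Suc K) a"
  shows "norm (pot_grad a x - pot_grad a x') \<le> l / 2 * norm (x - x')"
proof -
  define t t' h h' where "t = tl_coord a x" and "t' = tl_coord a x'"
    and "h = hd_coord a x" and "h' = hd_coord a x'"
  have diff: "t p - t' p = inner (prev a p) (x - x') / r" "h p - h' p = inner (a p) (x - x') / r" for p
    by (auto simp: t_def t'_def h_def h'_def tl_coord_def hd_coord_def prev_def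
        inner_diff_right diff_divide_distrib)
  have tail: "L2_set (\<lambda>p. t p - t' p) heads \<le> norm (x - x') / r"
    and head: "L2_set (\<lambda>p. h p - h' p) heads \<le> norm (x - x') / r"
    using r_pos bessel_suborthonormal[OF suborthonormal_family(1)[OF assms], of "x - x'"]
      bessel_suborthonormal[OF suborthonormal_family(2)[OF assms], of "x - x'"]
    by (auto simp: diff divide_inverse divide_right_mono simp flip: L2_set_left_distrib)
  have "norm (\<Sum>p\<in>heads. (link_v (t p) (h p) - link_v (t' p) (h' p)) *\<^sub>R prev a p)
      \<le> 4 * L2_set (\<lambda>p. t p - t' p) heads + 1 * L2_set (\<lambda>p. h p - h' p) heads"
    by (rule order_trans[OF norm_sum_suborthonormal[OF suborthonormal_family(2)[OF assms]]
          L2_set_le_lincomb]) (use link_v_lipschitz in auto)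
  moreover have "norm (\<Sum>p\<in>heads. (link_u (t p) (h p) - link_u (t' p) (h' p)) *\<^sub>R a p)
      \<le> 1 * L2_set (\<lambda>p. t p - t' p) heads + 2 * L2_set (\<lambda>p. h p - h' p) heads"
    by (rule order_trans[OF norm_sum_suborthonormal[OF suborthonormal_family(1)[OF assms]]
          L2_set_le_lincomb]) (auto intro: order_trans[OF link_u_lipschitz])
  \<comment> \<open>The constants \<open>4 + 1\<close> from \<open>link_v\<close> and
    \<open>1 + 2\<close> from \<open>link_u\<close> add up to 8; with the factor
    \<open>1 / r\<close> and the prefactor \<open>l * r / 16\<close> this becomes
    \<open>l / 2\<close>.\<close>
  ultimately have "norm ((\<Sum>p\<in>heads. (link_v (t p) (h p) - link_v (t' p) (h' p)) *\<^sub>R prev a p) +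
      (\<Sum>p\<in>heads. (link_u (t p) (h p) - link_u (t' p) (h' p)) *\<^sub>R a p)) \<le> 8 * (norm (x - x') / r)"
    using tail head by (intro order_trans[OF norm_triangle_ineq]) linarith
  then have "l * r / 16 * norm ((\<Sum>p\<in>heads. (link_v (t p) (h p) - link_v (t' p) (h' p)) *\<^sub>R prev a p) +
      (\<Sum>p\<in>heads. (link_u (t p) (h p) - link_u (t' p) (h' p)) *\<^sub>R a p))
    \<le> l * r / 16 * (8 * (norm (x - x') / r))"
    using l_pos r_pos by (intro mult_left_mono) auto
  moreover have "pot_grad a x - pot_grad a x' = (l * r / 16) *\<^sub>R
      ((\<Sum>p\<in>heads. (link_v (t p) (h p) - link_v (t' p) (h' p)) *\<^sub>R prev a p) +
      (\<Sum>p\<in>heads. (link_u (t p) (h p) - link_u (t' p) (h' p)) *\<^sub>R a p))"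
    by (simp add: pot_grad_def t_def t'_def h_def h'_def scaleR_diff_left sum_subtractf
        scaleR_diff_right scaleR_add_right)
  ultimately show ?thesis using l_pos r_pos by simp
qed

text \<open>The constant \<open>l\<close> is spent as \<open>l / 2\<close> on the potential and
  \<open>l / 4\<close> on each of the two coupling components, that is \<open>l / 8\<close> times
  the norm bound 2.\<close>

lemma smooth_obj_obj:
  assumes ab: "range a \<subseteq> Rn m" "range b \<subseteq> Rn n" "0 < R"
    and orth: "orthonormal_upto (T * Suc K) a" "orthonormal_upto (T * Suc K) b"
  shows "smooth_obj l (ball_domain m n R) (obj a b)"
  unfolding smooth_obj_def
proof (intro conjI ballI)
  show "differentiable_obj (ball_domain m n R) (obj a b)"
    by (rule differentiable_obj_obj[OF ab])
  fix z z' assume "z \<in> dom_XY (ball_domain m n R)" "z' \<in> dom_XY (ball_domain m n R)"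
  then have grad: "gradient (dom_XY (ball_domain m n R)) (obj a b) z -
      gradient (dom_XY (ball_domain m n R)) (obj a b) z' = obj_grad a b z - obj_grad a b z'"
    by (simp add: gradient_obj[OF ab])
  define x x' y y' where "x = fst z" and "x' = fst z'" and "y = snd z" and "y' = snd z'"
  have "obj_grad a b z - obj_grad a b z' =
      (pot_grad a x - pot_grad a x' + (l / 8) *\<^sub>R coup_adj a b (y - y'), (l / 8) *\<^sub>R coup a b (x - x'))"
    by (simp add: obj_grad_def x_def x'_def y_def y'_def linear_diff[OF linear_coup]
        linear_diff[OF linear_coup_adj] scaleR_diff_right)
  also have "norm \<dots> \<le> norm (pot_grad a x - pot_grad a x') +
      norm ((l / 8) *\<^sub>R coup_adj a b (y - y')) + norm ((l / 8) *\<^sub>R coup a b (x - x'))"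
    by (intro order_trans[OF norm_Pair_le] add_mono norm_triangle_ineq order_refl)
  also have "\<dots> \<le> l / 2 * norm (x - x') + l / 8 * (2 * norm (y - y')) + l / 8 * (2 * norm (x - x'))"
    unfolding norm_scaleR using l_pos
    by (intro add_mono norm_pot_grad_diff_le orth mult_mono norm_coup_adj_le norm_coup_le) auto
  also have "\<dots> \<le> l / 2 * norm (z - z') + l / 8 * (2 * norm (z - z')) + l / 8 * (2 * norm (z - z'))"
    using l_pos norm_fst_le[of "x - x'" "y - y'"] norm_snd_le[of "y - y'" "x - x'"]
    by (intro add_mono mult_left_mono) (auto simp: x_def x'_def y_def y'_def minus_prod_def)
  also have "\<dots> = l * norm (z - z')" by simp
  finally show "norm (gradient (dom_XY (ball_domain m n R)) (obj a b) z -
      gradient (dom_XY (ball_domain m n R)) (obj a b) z') \<le> l * norm (z - z')"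
    unfolding grad .
qed

section \<open>Primal function and membership in the class\<close>

lemma Phi_obj:
  assumes "x \<in> Rn m" "range b \<subseteq> Rn n" "0 \<le> R"
  shows "Phi (ball_domain m n R) (obj a b) x = ereal (pot a x + l / 8 * R * norm (coup a b x))"
proof -
  have "Phi (ball_domain m n R) (obj a b) x =
      (SUP y\<in>{y \<in> Rn n. norm y \<le> R}. ereal (pot a x + inner y ((l / 8) *\<^sub>R coup a b x)))"
    using assms by (simp add: Phi_def obj_def)
  also have "\<dots> = ereal (pot a x + R * norm ((l / 8) *\<^sub>R coup a b x))"
    by (intro SUP_inner_ball_Rn subspace_scale[OF subspace_Rn] coup_in_Rn assms)
  finally show ?thesis using l_pos by (simp add: mult_ac)
qed

lemma pot_ge: "- (l * r\<^sup>2 / 16 * T) \<le> pot a x"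
proof -
  have "(\<Sum>p\<in>heads. - 1) \<le> (\<Sum>p\<in>heads. link (tl_coord a x p) (hd_coord a x p))"
    by (intro sum_mono link_ge)
  then have "l * r\<^sup>2 / 16 * - T \<le> pot a x"
    unfolding pot_def using l_pos by (intro mult_left_mono) (auto simp: card_heads)
  then show ?thesis by simp
qed

lemma obj_in_saddle_class:
  assumes ab: "range a \<subseteq> Rn m" "range b \<subseteq> Rn n" "0 < R"
    and orth: "orthonormal_upto (T * Suc K) a" "orthonormal_upto (T * Suc K) b"
    and D: "2 * R \<le> D" and Delta: "l * r\<^sup>2 / 16 * T \<le> \<Delta>"
  shows "(ball_domain m n R, obj a b) \<in> saddle_class l D \<Delta>"
proof -
  let ?d = "ball_domain m n R"
  have "concave_on (setY ?d) (\<lambda>y. obj a b (x, y))" for x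
  proof -
    have "convex (setY ?d)"
      using admissible_ball_domain[of R m n] ab(3) by (simp add: admissible_domain_def)
    moreover have "obj a b (x, y) = pot a x + inner y ((l / 8) *\<^sub>R coup a b x)" for y
      by (simp add: obj_def)
    ultimately show ?thesis
      unfolding concave_on_def by (intro convex_onI) (simp_all add: inner_add_left algebra_simps del: inner_scaleR_right)
  qed
  moreover have "Phi ?d (obj a b) 0 - (INF x\<in>setX ?d. Phi ?d (obj a b) x) \<le> ereal \<Delta>"
  proof -
    \<comment> \<open>At the origin all heads vanish and so does the coupling, hence
      \<open>Phi\<close> is at most 0 there and the gap is controlled by
      \<open>pot_ge\<close>.\<close>
    have "pot a 0 \<le> 0"
      unfolding pot_def hd_coord_def using l_pos
      by (auto intro!: mult_nonneg_nonpos sum_nonpos link_at_0_le)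
    then have "Phi ?d (obj a b) 0 \<le> 0"
      using ab linear_0[OF linear_coup] by (simp add: Phi_obj subspace_0[OF subspace_Rn])
    moreover have "ereal (- \<Delta>) \<le> (INF x\<in>setX ?d. Phi ?d (obj a b) x)"
    proof (rule INF_greatest)
      fix x assume "x \<in> setX ?d"
      moreover have "- \<Delta> \<le> pot a x + l / 8 * R * norm (coup a b x)"
        using pot_ge[of a x] Delta l_pos ab(3) by (intro add_increasing2) auto
      ultimately show "ereal (- \<Delta>) \<le> Phi ?d (obj a b) x"
        using ab by (simp add: Phi_obj)
    qed
    ultimately have "Phi ?d (obj a b) 0 - (INF x\<in>setX ?d. Phi ?d (obj a b) x) \<le> 0 - ereal (- \<Delta>)"
      by (rule ereal_minus_mono)
    then show ?thesis by simp
  qed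
  ultimately show ?thesis
    using admissible_ball_domain[of R m n] bounded_ball_domain diameter_ball_domain[of R m n]
      smooth_obj_obj[OF ab orth] D ab(3)
    by (simp add: saddle_class_def)
qed

subsection \<open>Non-stationarity while the last coordinate is undiscovered\<close>

declare mult_Suc_right [simp del]

text \<open>
  Both partial derivatives of \<open>link\<close> being nonpositive, moving coordinates upwards never
  increases the potential to first order.
\<close>

lemma inner_pot_grad_upward_le:
  assumes orth: "orthonormal_upto (T * Suc K) a" and \<kappa>: "\<And>p. 0 \<le> \<kappa> p" and J: "J \<subseteq> heads"
  shows "inner (pot_grad a x) (\<Sum>p<T * Suc K. \<kappa> p *\<^sub>R a p) \<le>
    l * r / 16 * (\<Sum>p\<in>J. link_u (tl_coord a x p) (hd_coord a x p) * \<kappa> p)"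
proof -
  let ?v = "\<Sum>p<T * Suc K. \<kappa> p *\<^sub>R a p"
  let ?u = "\<lambda>p. link_u (tl_coord a x p) (hd_coord a x p)"
  let ?w = "\<lambda>p. link_v (tl_coord a x p) (hd_coord a x p)"
  \<comment> \<open>By orthonormality this is the coefficient at \<open>p - 1\<close>, or 0 when
    \<open>p = 0\<close>.\<close>
  have "0 \<le> inner (prev a p) ?v" if "p \<in> heads" for p
    using that \<kappa> by (auto simp: prev_def heads_def inner_combination[OF orth])
  then have "(\<Sum>p\<in>heads. ?w p * inner (prev a p) ?v) \<le> 0"
    by (intro sum_nonpos mult_nonpos_nonneg link_v_nonpos)
  moreover have "(\<Sum>p\<in>heads. ?u p * inner (a p) ?v) = (\<Sum>p\<in>heads. ?u p * \<kappa> p)"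
    by (intro sum.cong) (auto simp: heads_def inner_combination[OF orth])
  moreover have "(\<Sum>p\<in>heads - J. ?u p * \<kappa> p) \<le> 0"
    using \<kappa> by (intro sum_nonpos mult_nonpos_nonneg link_u_nonpos)
  then have "(\<Sum>p\<in>heads. ?u p * \<kappa> p) \<le> (\<Sum>p\<in>J. ?u p * \<kappa> p)"
    using sum.subset_diff[OF J finite_heads, of "\<lambda>p. ?u p * \<kappa> p"] by simp
  ultimately have "(\<Sum>p\<in>heads. ?w p * inner (prev a p) ?v) + (\<Sum>p\<in>heads. ?u p * inner (a p) ?v)
      \<le> (\<Sum>p\<in>J. ?u p * \<kappa> p)"
    by linarith
  then show ?thesis
    unfolding pot_grad_def inner_scaleR_left inner_add_left inner_sum_left
    using l_pos r_pos by (intro mult_left_mono) auto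
qed

section \<open>Weights and jumps along a block\<close>

lemma wt_block:
  assumes "j \<le> K"
  shows "wt (i * Suc K + j) = (if j = 0 \<or> j = K then 1 / sqrt K else 1)"
proof -
  have "Suc K dvd i * Suc K + j \<longleftrightarrow> Suc K dvd j" by (rule dvd_add_right_iff) simp
  moreover have "Suc K dvd j \<longleftrightarrow> j = 0" using assms by (auto dest: dvd_imp_le)
  moreover have "Suc K dvd i * Suc K + Suc j \<longleftrightarrow> Suc K dvd Suc j" by (rule dvd_add_right_iff) simp
  moreover have "Suc K dvd Suc j \<longleftrightarrow> j = K" using assms by (auto dest: dvd_imp_le)
  ultimately show ?thesis by (simp add: wt_def)
qed

text \<open>The two ends contribute \<open>K\<close> each and every inner index contributes
  1.\<close>

lemma sum_inverse_wt_block: "(\<Sum>j<Suc K. 1 / (wt (i * Suc K + j))\<^sup>2) \<le> 3 * K"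
proof -
  have "(\<Sum>j<Suc K. 1 / (wt (i * Suc K + j))\<^sup>2) \<le>
      (\<Sum>j<Suc K. (if j = 0 then real K else 0) + (if j = K then real K else 1))"
  proof (rule sum_mono)
    fix j assume "j \<in> {..<Suc K}"
    then show "1 / (wt (i * Suc K + j))\<^sup>2 \<le>
        (if j = 0 then real K else 0) + (if j = K then real K else 1)"
      using K_pos by (auto simp: wt_block power_divide)
  qed
  also have "\<dots> = 3 * K" by (simp add: sum.distrib)
  finally show ?thesis .
qed

lemma sum_blocks: "(\<Sum>p<T * Suc K. g p) = (\<Sum>i<T. \<Sum>j<Suc K. g (i * Suc K + j))" for g :: "nat \<Rightarrow> real"
proof -
  have "(\<Sum>j<Suc K. g (i * Suc K + j)) = sum g {i * Suc K..<i * Suc K + Suc K}" for i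
    using sum.shift_bounds_nat_ivl[of g 0 "i * Suc K" "Suc K"]
    by (simp add: lessThan_atLeast0 add.commute)
  then show ?thesis by (simp only: sum.nat_group)
qed

text \<open>The extension by zero to the heads lets sums run over whole blocks.\<close>

definition jump :: "(nat \<Rightarrow> fvec) \<Rightarrow> fvec \<Rightarrow> nat \<Rightarrow> real" where
  "jump a x p = (if p \<in> rest then inner (edge a p) x else 0)"

lemma norm_coup:
  assumes "orthonormal_upto (T * Suc K) b"
  shows "(norm (coup a b x))\<^sup>2 = (\<Sum>p<T * Suc K. (jump a x p)\<^sup>2)"
proof -
  have "coup a b x = (\<Sum>p<T * Suc K. jump a x p *\<^sub>R b p)"
    unfolding coup_def by (rule sum.mono_neutral_cong_left) (auto simp: rest_def jump_def)
  then have "(norm (coup a b x))\<^sup>2 = (\<Sum>p<T * Suc K. jump a x p * inner (b p) (\<Sum>p<T * Suc K. jump a x p *\<^sub>R b p))"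
    by (simp add: power2_norm_eq_inner inner_sum_left)
  also have "\<dots> = (\<Sum>p<T * Suc K. (jump a x p)\<^sup>2)"
    by (intro sum.cong) (simp_all add: inner_combination[OF assms] power2_eq_square)
  finally show ?thesis .
qed

definition block_jumps :: "(nat \<Rightarrow> fvec) \<Rightarrow> fvec \<Rightarrow> nat \<Rightarrow> real" where
  "block_jumps a x i = (\<Sum>j<Suc K. \<bar>jump a x (i * Suc K + j)\<bar>)"

lemma block_index_less:
  assumes "i < T" "j \<le> K"
  shows "i * Suc K + j < T * Suc K"
proof -
  have "i * Suc K + j < Suc i * Suc K" using assms by simp
  also have "\<dots> \<le> T * Suc K" using assms by (intro mult_le_mono1) simp
  finally show ?thesis .
qed

lemma in_rest_iff: "i < T \<Longrightarrow> j \<le> K \<Longrightarrow> i * Suc K + j \<in> rest \<longleftrightarrow> j \<noteq> 0"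
  using block_index_less[of i j] dvd_add_right_iff[of "Suc K" "i * Suc K" j]
  by (cases "j = 0") (auto simp: rest_def dest: dvd_imp_le)

text \<open>The jumps telescope from the head of the block to position \<open>j\<close>.\<close>

lemma weighted_coordinate_in_block:
  assumes "i < T" "j \<le> K"
  shows "\<bar>wt (i * Suc K) * inner (a (i * Suc K)) x -
      wt (i * Suc K + j) * inner (a (i * Suc K + j)) x\<bar> \<le> block_jumps a x i"
proof -
  have "wt (i * Suc K) * inner (a (i * Suc K)) x - wt (i * Suc K + j) * inner (a (i * Suc K + j)) x =
      (\<Sum>k<Suc j. jump a x (i * Suc K + k))"
    using assms(2)
  proof (induction j)
    case 0
    then show ?case using assms(1) in_rest_iff[of i 0] by (simp add: jump_def)
  next
    case (Suc j)
    then show ?case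
      using assms(1) in_rest_iff[of i "Suc j"]
      by (simp add: jump_def edge_def inner_diff_left)
  qed
  also have "\<bar>\<dots>\<bar> \<le> (\<Sum>k<Suc j. \<bar>jump a x (i * Suc K + k)\<bar>)"
    by (rule sum_abs)
  also have "\<dots> \<le> block_jumps a x i"
    unfolding block_jumps_def using assms(2) by (intro sum_mono2) auto
  finally show ?thesis .
qed

text \<open>Cauchy-Schwarz on the \<open>K + 1\<close> terms of a block costs the factor
  \<open>K + 1 \<le> 2 * K\<close>.\<close>

lemma sum_block_jumps_le:
  assumes "orthonormal_upto (T * Suc K) b"
  shows "(\<Sum>i<T. (block_jumps a x i)\<^sup>2) \<le> 2 * K * (norm (coup a b x))\<^sup>2"
proof -
  have "(\<Sum>i<T. (block_jumps a x i)\<^sup>2) \<le> (\<Sum>i<T. (\<Sum>j<Suc K. (jump a x (i * Suc K + j))\<^sup>2) * Suc K)"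
  proof (rule sum_mono)
    fix i
    show "(block_jumps a x i)\<^sup>2 \<le> (\<Sum>j<Suc K. (jump a x (i * Suc K + j))\<^sup>2) * Suc K"
      using sum_squared_le_sum_of_squares[of "\<lambda>j. \<bar>jump a x (i * Suc K + j)\<bar>" "{..<Suc K}"]
      by (simp add: block_jumps_def)
  qed
  also have "\<dots> = (norm (coup a b x))\<^sup>2 * Suc K"
    by (simp only: norm_coup[OF assms] sum_blocks sum_distrib_right)
  also have "\<dots> \<le> (norm (coup a b x))\<^sup>2 * (2 * K)"
    using K_pos by (intro mult_left_mono) auto
  finally show ?thesis by (simp add: mult_ac)
qed

text \<open>
  First-order optimality of the proximal point along a direction that shrinks the coupling term
  by the factor \<open>1 - c t\<close>; the coupling term itself need not be differentiable.
\<close>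

lemma prox_first_order:
  assumes min: "\<And>z'. z' \<in> Rn m \<Longrightarrow>
      pot a z + \<rho> * norm (coup a b z) + l * (norm (x - z))\<^sup>2 \<le>
      pot a z' + \<rho> * norm (coup a b z') + l * (norm (x - z'))\<^sup>2"
    and near: "2 * l * norm (x - z) \<le> \<epsilon>"
    and zv: "z \<in> Rn m" "v \<in> Rn m"
    and c: "coup a b v = - c *\<^sub>R coup a b z" "c \<le> 1"
  shows "c * \<rho> * norm (coup a b z) \<le> inner (pot_grad a z) v + \<epsilon> * norm v"
proof -
  \<comment> \<open>For \<open>0 \<le> t \<le> 1\<close> this is the proximal objective at
    \<open>z + t *\<^sub>R v\<close>: there \<open>1 - c * t\<close> is nonnegative and factors out
    of the norm. Unlike the norm, \<open>\<psi>\<close> is differentiable in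
    \<open>t\<close>.\<close>
  define \<psi> where "\<psi> t = pot a (z + t *\<^sub>R v) + (1 - c * t) * (\<rho> * norm (coup a b z)) +
      l * ((norm (x - z))\<^sup>2 - 2 * t * inner (x - z) v + t\<^sup>2 * (norm v)\<^sup>2)" for t :: real
  have ge: "\<psi> 0 \<le> \<psi> t" if "0 \<le> t" "t \<le> 1" for t
  proof -
    have "z + t *\<^sub>R v \<in> Rn m" using zv by (intro subspace_add subspace_scale subspace_Rn)
    from min[OF this] have "\<psi> 0 \<le> pot a (z + t *\<^sub>R v) + \<rho> * norm (coup a b (z + t *\<^sub>R v)) +
        l * (norm (x - (z + t *\<^sub>R v)))\<^sup>2"
      by (simp add: \<psi>_def)
    also have "norm (coup a b (z + t *\<^sub>R v)) = (1 - c * t) * norm (coup a b z)"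
    proof -
      have "coup a b (z + t *\<^sub>R v) = coup a b z + t *\<^sub>R coup a b v"
        by (simp only: linear_add[OF linear_coup] linear_cmul[OF linear_coup])
      also have "\<dots> = (1 - c * t) *\<^sub>R coup a b z"
        unfolding c(1) by (simp add: scaleR_left_diff_distrib mult.commute)
      finally show ?thesis using mult_right_mono[OF c(2) that(1)] that(2) by simp
    qed
    also have "(norm (x - (z + t *\<^sub>R v)))\<^sup>2 =
        (norm (x - z))\<^sup>2 - 2 * t * inner (x - z) v + t\<^sup>2 * (norm v)\<^sup>2"
    proof -
      have "(norm (e - t *\<^sub>R v))\<^sup>2 = (norm e)\<^sup>2 - 2 * t * inner e v + t\<^sup>2 * (norm v)\<^sup>2" for e
        unfolding power2_norm_eq_inner
        by (simp add: inner_diff_left inner_diff_right inner_commute[of v e] power2_eq_square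
            right_diff_distrib)
      from this[of "x - z"] show ?thesis by (simp only: diff_diff_eq)
    qed
    also have "pot a (z + t *\<^sub>R v) + \<rho> * ((1 - c * t) * norm (coup a b z)) +
        l * ((norm (x - z))\<^sup>2 - 2 * t * inner (x - z) v + t\<^sup>2 * (norm v)\<^sup>2) = \<psi> t"
      by (simp only: \<psi>_def mult.left_commute)
    finally show ?thesis .
  qed
  have "((\<lambda>t. pot a (z + t *\<^sub>R v)) has_real_derivative inner (pot_grad a z) v) (at 0)"
  proof -
    have "((\<lambda>t. z + t *\<^sub>R v) has_derivative (\<lambda>t. t *\<^sub>R v)) (at 0)"
      by (auto intro!: derivative_eq_intros)
    from has_derivative_compose[OF this has_derivative_pot, of a]
    show ?thesis by (simp add: has_field_derivative_def mult_commute_abs)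
  qed
  then have deriv: "(\<psi> has_real_derivative inner (pot_grad a z) v - c * (\<rho> * norm (coup a b z))
      - l * (2 * inner (x - z) v)) (at 0)"
    unfolding \<psi>_def [abs_def] by (auto intro!: derivative_eq_intros)
  \<comment> \<open>A negative derivative would give a small \<open>t\<close> in the unit interval
    with \<open>\<psi> t < \<psi> 0\<close>.\<close>
  have "0 \<le> inner (pot_grad a z) v - c * (\<rho> * norm (coup a b z)) - l * (2 * inner (x - z) v)"
  proof (rule ccontr)
    assume "\<not> ?thesis"
    then obtain d where d: "d > 0" "\<And>h. h > 0 \<Longrightarrow> h < d \<Longrightarrow> \<psi> (0 + h) < \<psi> 0"
      using DERIV_neg_dec_right[OF deriv] by auto
    have "0 < min (d / 2) 1" "min (d / 2) 1 < d" using d(1) by auto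
    with d(2)[of "min (d / 2) 1"] ge[of "min (d / 2) 1"] show False by simp
  qed
  moreover have "- (l * (2 * inner (x - z) v)) \<le> \<epsilon> * norm v"
  proof -
    have "- inner (x - z) v \<le> norm (x - z) * norm v"
      using Cauchy_Schwarz_ineq2[of "x - z" v] by linarith
    then have "2 * l * - inner (x - z) v \<le> 2 * l * (norm (x - z) * norm v)"
      using l_pos by (intro mult_left_mono) auto
    also have "\<dots> = 2 * l * norm (x - z) * norm v" by (simp only: mult.assoc)
    also have "\<dots> \<le> \<epsilon> * norm v" by (intro mult_right_mono near) simp
    finally show ?thesis by (simp only: mult_minus_right mult.assoc mult.left_commute)
  qed
  ultimately show ?thesis unfolding mult.assoc by linarith
qed

text \<open>A stationary \<open>x\<close> has a proximal point \<open>z\<close> within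
  \<open>\<epsilon> / (2 * l)\<close>. Optimality of \<open>z\<close> first excludes jumps, then
  forces block after block up to level \<open>r\<close>; this puts the last coordinate of
  \<open>z\<close> too far from that of \<open>x\<close>, which is 0.\<close>

lemma not_eps_OS_if_last_undiscovered:
  assumes ab: "range a \<subseteq> Rn m" "range b \<subseteq> Rn n" "0 < R"
    and orth: "orthonormal_upto (T * Suc K) a" "orthonormal_upto (T * Suc K) b"
    and T: "0 < T" and \<epsilon>: "0 < \<epsilon>" and r: "l * r = 128 * \<epsilon>" and R: "64 * \<epsilon> * K \<le> l * R"
    and x: "inner (a (T * Suc K - 1)) x = 0"
  shows "\<not> eps_OS l \<epsilon> (ball_domain m n R) (obj a b) x"
proof
  let ?P = "T * Suc K"
  define \<rho> where "\<rho> = l / 8 * R"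
  assume OS: "eps_OS l \<epsilon> (ball_domain m n R) (obj a b) x"
  have "continuous_on (Rn m) (pot a)"
    by (rule has_derivative_continuous_on) (rule has_derivative_pot)
  then have cont: "continuous_on (Rn m) (\<lambda>z. pot a z + \<rho> * norm (coup a b z))"
    by (intro continuous_intros linear_continuous_on[OF bounded_linear_coup])
  have lower: "- (l * r\<^sup>2 / 16 * T) \<le> pot a z + \<rho> * norm (coup a b z)" for z
    using pot_ge[of a z] l_pos ab(3) by (simp add: \<rho>_def add_increasing2)
  obtain z where z: "z \<in> Rn m" and near: "2 * l * norm (x - z) \<le> \<epsilon>"
    and min: "\<And>z'. z' \<in> Rn m \<Longrightarrow>
      pot a z + \<rho> * norm (coup a b z) + l * (norm (x - z))\<^sup>2 \<le>
      pot a z' + \<rho> * norm (coup a b z') + l * (norm (x - z'))\<^sup>2"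
  proof (rule eps_OS_imp_near_prox_point[OF _ _ _ _ l_pos OS])
    show "Phi (ball_domain m n R) (obj a b) z = ereal (pot a z + \<rho> * norm (coup a b z))"
      if "z \<in> Rn (dimX (ball_domain m n R))" for z
      using that ab by (simp add: Phi_obj \<rho>_def)
  qed (use cont lower in auto)
  have first_order: "c * \<rho> * norm (coup a b z) \<le> inner (pot_grad a z) v + \<epsilon> * norm v"
    if "v \<in> Rn m" "coup a b v = - c *\<^sub>R coup a b z" "c \<le> 1" for c v
    by (rule prox_first_order[OF _ near z that]) (rule min)
  let ?w = "\<lambda>p. inner (a p) z"
  have comb_in: "(\<Sum>p<?P. \<kappa> p *\<^sub>R a p) \<in> Rn m" for \<kappa>
    using ab(1) by (intro subspace_sum subspace_scale subspace_Rn) auto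
  have norm_comb: "norm (\<Sum>p<?P. \<kappa> p *\<^sub>R a p) \<le> L2_set \<kappa> {..<?P}" for \<kappa>
    by (intro norm_sum_suborthonormal suborthonormal_family orth)
  have jump_comb: "coup a b (\<Sum>p<?P. \<kappa> p *\<^sub>R a p) =
      (\<Sum>p\<in>rest. (wt (p - 1) * \<kappa> (p - 1) - wt p * \<kappa> p) *\<^sub>R b p)" for \<kappa>
    unfolding coup_def
    by (intro sum.cong refl arg_cong2[where f = scaleR])
      (auto simp: edge_def inner_diff_left rest_def inner_combination[OF orth(1)])
  have coup_0: "coup a b z = 0"
  proof (rule ccontr)
    assume nz: "coup a b z \<noteq> 0"
    \<comment> \<open>\<open>W i\<close> bounds all weighted coordinates of block \<open>i\<close>
      from above. The direction \<open>v\<close> lifts each of them to this level, so it only moves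
      upwards and cancels all jumps.\<close>
    define W where "W i = wt (i * Suc K) * ?w (i * Suc K) + block_jumps a z i" for i
    define \<kappa> where "\<kappa> p = (if p < ?P then (W (p div Suc K) - wt p * ?w p) / wt p else 0)" for p
    define v where "v = (\<Sum>p<?P. \<kappa> p *\<^sub>R a p)"
    have \<kappa>_block: "0 \<le> \<kappa> (i * Suc K + j)"
      "\<kappa> (i * Suc K + j) \<le> 2 * block_jumps a z i / wt (i * Suc K + j)" if "i < T" "j \<le> K" for i j
    proof -
      have "(i * Suc K + j) div Suc K = i" using that(2) by simp
      then have eq: "\<kappa> (i * Suc K + j) =
          (W i - wt (i * Suc K + j) * ?w (i * Suc K + j)) / wt (i * Suc K + j)"
        using block_index_less[OF that] by (simp add: \<kappa>_def)
      have "0 \<le> W i - wt (i * Suc K + j) * ?w (i * Suc K + j)"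
        "W i - wt (i * Suc K + j) * ?w (i * Suc K + j) \<le> 2 * block_jumps a z i"
        using weighted_coordinate_in_block[OF that, of a z] unfolding W_def abs_le_iff by linarith+
      then show "0 \<le> \<kappa> (i * Suc K + j)"
        "\<kappa> (i * Suc K + j) \<le> 2 * block_jumps a z i / wt (i * Suc K + j)"
        unfolding eq using wt_bounds[of "i * Suc K + j"] by (auto intro: divide_right_mono)
    qed
    have \<kappa>_nonneg: "0 \<le> \<kappa> p" for p
    proof (cases "p < ?P")
      case True
      then have "p div Suc K < T" by (simp only: less_mult_imp_div_less)
      then have "0 \<le> \<kappa> (p div Suc K * Suc K + p mod Suc K)"
        by (rule \<kappa>_block) (simp flip: less_Suc_eq_le)
      then show ?thesis by (simp only: div_mult_mod_eq)
    qed (simp add: \<kappa>_def)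
    have "coup a b v = - 1 *\<^sub>R coup a b z"
    proof -
      have "wt (p - 1) * \<kappa> (p - 1) - wt p * \<kappa> p = - inner (edge a p) z" if "p \<in> rest" for p
      proof -
        have "p < ?P" "p - 1 < ?P" "Suc (p - 1) = p" "\<not> Suc K dvd p"
          using that rest_pos[OF that] by (auto simp: rest_def)
        moreover from this have "(p - 1) div Suc K = p div Suc K"
          by (metis div_Suc dvd_eq_mod_eq_0)
        ultimately show ?thesis
          using wt_bounds[of p] wt_bounds[of "p - 1"]
          by (simp add: \<kappa>_def edge_def inner_diff_left)
      qed
      then show ?thesis
        unfolding v_def jump_comb by (simp add: coup_def sum_negf)
    qed
    from first_order[OF comb_in[of \<kappa>, folded v_def] this]
    have "\<rho> * norm (coup a b z) \<le> inner (pot_grad a z) v + \<epsilon> * norm v" by simp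
    moreover have "inner (pot_grad a z) v \<le> 0"
      using inner_pot_grad_upward_le[OF orth(1), of \<kappa> "{}" z] \<kappa>_nonneg by (simp add: v_def)
    moreover have "norm v \<le> 5 * K * norm (coup a b z)"
    proof -
      have "(L2_set \<kappa> {..<?P})\<^sup>2 = (\<Sum>i<T. \<Sum>j<Suc K. (\<kappa> (i * Suc K + j))\<^sup>2)"
        by (simp only: L2_set_def sum_blocks real_sqrt_pow2 sum_nonneg zero_le_power2)
      also have "\<dots> \<le> (\<Sum>i<T. \<Sum>j<Suc K. 4 * (block_jumps a z i)\<^sup>2 * (1 / (wt (i * Suc K + j))\<^sup>2))"
      proof (intro sum_mono)
        fix i j assume "i \<in> {..<T}" "j \<in> {..<Suc K}"
        then have "(\<kappa> (i * Suc K + j))\<^sup>2 \<le> (2 * block_jumps a z i / wt (i * Suc K + j))\<^sup>2"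
          by (intro power_mono \<kappa>_block) auto
        then show "(\<kappa> (i * Suc K + j))\<^sup>2 \<le>
            4 * (block_jumps a z i)\<^sup>2 * (1 / (wt (i * Suc K + j))\<^sup>2)"
          by (simp add: power_divide power_mult_distrib)
      qed
      also have "\<dots> \<le> (\<Sum>i<T. 4 * (block_jumps a z i)\<^sup>2 * (3 * K))"
        unfolding sum_distrib_left[symmetric] by (intro sum_mono mult_left_mono sum_inverse_wt_block) simp
      also have "\<dots> = 12 * K * (\<Sum>i<T. (block_jumps a z i)\<^sup>2)"
        by (simp add: sum_distrib_left mult_ac)
      also have "\<dots> \<le> 12 * K * (2 * K * (norm (coup a b z))\<^sup>2)"
        by (intro mult_left_mono sum_block_jumps_le orth) simp
      \<comment> \<open>The constant \<open>12 * 2 = 24\<close> is rounded up to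
        \<open>5\<^sup>2\<close>.\<close>
      also have "\<dots> \<le> (5 * K * norm (coup a b z))\<^sup>2"
        by (simp add: power_mult_distrib power2_eq_square mult_right_mono)
      finally have "L2_set \<kappa> {..<?P} \<le> 5 * K * norm (coup a b z)"
        by (rule power2_le_imp_le) simp
      then show ?thesis using norm_comb[of \<kappa>] by (simp add: v_def)
    qed
    then have "\<epsilon> * norm v \<le> \<epsilon> * (5 * K * norm (coup a b z))"
      using \<epsilon> by (intro mult_left_mono) auto
    ultimately have "\<rho> * norm (coup a b z) \<le> (5 * \<epsilon> * K) * norm (coup a b z)"
      by (simp add: mult_ac)
    then have "\<rho> \<le> 5 * \<epsilon> * K" using nz by simp
    \<comment> \<open>The penalty gained by removing the jumps exceeds the proximal cost
      \<open>5 * \<epsilon> * K\<close> of the move.\<close>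
    moreover have "8 * (\<epsilon> * K) \<le> \<rho>" using R by (simp add: \<rho>_def)
    moreover have "0 < \<epsilon> * K" using \<epsilon> K_pos by simp
    ultimately show False by linarith
  qed

  have "jump a z p = 0" if "p < ?P" for p
    using norm_coup[OF orth(2), of a z] coup_0 that
    by (simp add: sum_nonneg_eq_0_iff)
  then have "block_jumps a z i = 0" if "i < T" for i
    using that block_index_less[of i] by (auto simp: block_jumps_def less_Suc_eq_le intro!: sum.neutral)
  \<comment> \<open>Both ends of a block carry the same weight, so equal weighted coordinates are
    equal coordinates.\<close>
  then have ends: "?w (i * Suc K + K) = ?w (i * Suc K)" if "i < T" for i
    using weighted_coordinate_in_block[OF that order_refl, of a z] that wt_block[of 0 i] wt_block[of K i] K_pos
    by simp

  \<comment> \<open>If the link is on and the head is below 1, block \<open>i\<close> can be raised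
    without jumps. The potential then falls at rate at least \<open>2 * \<epsilon>\<close>, while
    the proximal term charges at most \<open>\<epsilon> * sqrt 3\<close>.\<close>
  have advance: "1 \<le> hd_coord a z (i * Suc K)" if i: "i < T" and "1 \<le> tl_coord a z (i * Suc K)" for i
  proof (rule ccontr)
    assume "\<not> ?thesis"
    then have small: "link_u (tl_coord a z (i * Suc K)) (hd_coord a z (i * Suc K)) \<le> - 1/4"
      using that by (intro link_u_le) auto
    \<comment> \<open>All weighted coefficients of the block equal \<open>1 / sqrt K\<close>, so
      there is no jump, and the head coefficient is 1.\<close>
    define \<kappa> where "\<kappa> p = (if p div Suc K = i then 1 / (wt p * sqrt K) else 0)" for p
    define v where "v = (\<Sum>p<?P. \<kappa> p *\<^sub>R a p)"
    have \<kappa>_nonneg: "0 \<le> \<kappa> p" for p using wt_bounds[of p] by (simp add: \<kappa>_def)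
    have "coup a b v = 0"
    proof -
      have "wt (p - 1) * \<kappa> (p - 1) - wt p * \<kappa> p = 0" if "p \<in> rest" for p
      proof -
        have "Suc (p - 1) = p" "\<not> Suc K dvd p"
          using that rest_pos[OF that] by (auto simp: rest_def)
        then have "(p - 1) div Suc K = p div Suc K"
          by (metis div_Suc dvd_eq_mod_eq_0)
        then show ?thesis
          using wt_bounds[of p] wt_bounds[of "p - 1"] by (simp add: \<kappa>_def)
      qed
      then show ?thesis unfolding v_def jump_comb by simp
    qed
    then have "0 \<le> inner (pot_grad a z) v + \<epsilon> * norm v"
      using first_order[OF comb_in[of \<kappa>, folded v_def], where c = 0] by simp
    moreover have "inner (pot_grad a z) v \<le>
        l * r / 16 * (link_u (tl_coord a z (i * Suc K)) (hd_coord a z (i * Suc K)) * \<kappa> (i * Suc K))"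
      using inner_pot_grad_upward_le[OF orth(1), of \<kappa> "{i * Suc K}" z] \<kappa>_nonneg
        block_index_less[OF i, of 0]
      by (simp add: v_def heads_def)
    moreover have "\<kappa> (i * Suc K) = 1"
      using wt_block[of 0 i] K_pos by (simp add: \<kappa>_def)
    moreover have "norm v \<le> sqrt 3"
    proof -
      have "(L2_set \<kappa> {..<?P})\<^sup>2 = (\<Sum>i'<T. \<Sum>j<Suc K. (\<kappa> (i' * Suc K + j))\<^sup>2)"
        by (simp only: L2_set_def sum_blocks real_sqrt_pow2 sum_nonneg zero_le_power2)
      also have "\<dots> = (\<Sum>i'<T. if i' = i then \<Sum>j<Suc K. 1 / (wt (i * Suc K + j))\<^sup>2 / K else 0)"
      proof (intro sum.cong refl)
        fix i'
        have "(\<kappa> (i' * Suc K + j))\<^sup>2 = (if i' = i then 1 / (wt (i * Suc K + j))\<^sup>2 / K else 0)"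
          if "j \<in> {..<Suc K}" for j
        proof -
          have "(i' * Suc K + j) div Suc K = i'" using that by simp
          then show ?thesis by (auto simp: \<kappa>_def power_divide power_mult_distrib)
        qed
        then have "(\<Sum>j<Suc K. (\<kappa> (i' * Suc K + j))\<^sup>2) =
            (\<Sum>j<Suc K. if i' = i then 1 / (wt (i * Suc K + j))\<^sup>2 / K else 0)"
          by (rule sum.cong[OF refl])
        then show "(\<Sum>j<Suc K. (\<kappa> (i' * Suc K + j))\<^sup>2) =
            (if i' = i then \<Sum>j<Suc K. 1 / (wt (i * Suc K + j))\<^sup>2 / K else 0)"
          by (simp only: if_distrib sum.neutral_const split: if_splits) simp
      qed
      also have "\<dots> = (\<Sum>j<Suc K. 1 / (wt (i * Suc K + j))\<^sup>2) / K"
        using i by (simp only: sum.delta finite_lessThan lessThan_iff if_True sum_divide_distrib)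
      also have "\<dots> \<le> 3 * K / K"
        by (intro divide_right_mono sum_inverse_wt_block) simp
      finally have "(L2_set \<kappa> {..<?P})\<^sup>2 \<le> 3" using K_pos by simp
      then have "L2_set \<kappa> {..<?P} \<le> sqrt 3" by (rule real_le_rsqrt)
      then show ?thesis using norm_comb[of \<kappa>] by (simp add: v_def)
    qed
    then have "\<epsilon> * norm v \<le> \<epsilon> * sqrt 3" using \<epsilon> by simp
    moreover have "sqrt 3 < 2" by (rule real_less_lsqrt) auto
    then have "\<epsilon> * sqrt 3 < \<epsilon> * 2" using \<epsilon> by simp
    \<comment> \<open>The right side is \<open>- 2 * \<epsilon>\<close>, because
      \<open>l * r = 128 * \<epsilon>\<close>.\<close>
    moreover have "l * r / 16 * (link_u (tl_coord a z (i * Suc K)) (hd_coord a z (i * Suc K)) * 1)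
        \<le> l * r / 16 * (- 1/4)"
      using small l_pos r_pos by (intro mult_left_mono) auto
    ultimately show False using r by simp
  qed

  \<comment> \<open>Level 1 propagates: without jumps the end of a block equals its head, and it
    feeds the next link.\<close>
  have "1 \<le> hd_coord a z (i * Suc K)" if "i < T" for i
    using that
  proof (induction i)
    case 0
    then show ?case by (rule advance) (simp add: tl_coord_def)
  next
    case (Suc i)
    have "Suc i * Suc K - 1 = i * Suc K + K" "Suc i * Suc K \<noteq> 0" by simp_all
    moreover have "i < T" using Suc.prems by simp
    ultimately have "tl_coord a z (Suc i * Suc K) = hd_coord a z (i * Suc K)"
      by (simp only: tl_coord_def hd_coord_def if_False ends)
    with Suc.IH[OF \<open>i < T\<close>] have "1 \<le> tl_coord a z (Suc i * Suc K)" by simp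
    then show ?case by (rule advance[OF Suc.prems])
  qed
  \<comment> \<open>The last coordinate of \<open>z\<close> is at least \<open>r\<close> and that of
    \<open>x\<close> is 0, yet the points are within
    \<open>\<epsilon> / (2 * l) = r / 256\<close>.\<close>
  from this[of "T - 1"] have "r \<le> ?w ((T - 1) * Suc K)"
    using T r_pos by (simp add: hd_coord_def)
  also have "\<dots> = ?w ((T - 1) * Suc K + K)" using ends[of "T - 1"] T by simp
  also have "(T - 1) * Suc K + K = ?P - 1" using T by (cases T) auto
  also have "?w (?P - 1) = inner (a (?P - 1)) (z - x)" using x by (simp add: inner_diff_right)
  also have "\<dots> \<le> norm (a (?P - 1)) * norm (z - x)" by (rule norm_cauchy_schwarz)
  also have "norm (a (?P - 1)) = 1"
    using orth(1) T by (simp add: orthonormal_upto_def norm_eq_sqrt_inner)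
  finally have "l * r \<le> l * norm (x - z)" using l_pos by (simp add: norm_minus_commute)
  then show False using near r \<epsilon> by linarith
qed

lemma hitting_time_ge:
  assumes A: "A \<in> A_det" and T: "0 < T" and \<epsilon>: "0 < \<epsilon>" and r: "l * r = 128 * \<epsilon>"
    and R: "0 < R" "64 * \<epsilon> * K \<le> l * R" "2 * R \<le> D" and Delta: "l * r\<^sup>2 / 16 * T \<le> \<Delta>"
  shows "\<exists>(d, f)\<in>saddle_class l D \<Delta>. ereal (T * Suc K) \<le> hitting_time l \<epsilon> A d f"
proof -
  let ?P = "T * Suc K"
  \<comment> \<open>Dimension \<open>2 * ?P\<close> leaves room for a direction orthogonal to up to
    \<open>?P - 1\<close> earlier directions and \<open>?P\<close> queries.\<close>
  let ?d = "ball_domain (2 * ?P) (2 * ?P) R"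
  obtain a b where ab: "range a \<subseteq> Rn (2 * ?P)" "range b \<subseteq> Rn (2 * ?P)"
    and orth: "orthonormal_upto ?P a" "orthonormal_upto ?P b"
    and undisc: "\<And>s p. s \<le> p \<Longrightarrow> p < ?P \<Longrightarrow> inner (a p) (fst (A ?d (obj a b) s)) = 0"
  proof (rule resisting_oracle[OF A, where d = ?d and P = ?P and F = obj])
    show "admissible_domain ?d" using R(1) by (intro admissible_ball_domain) simp
    show "oracle_answer ?d (obj a b) z = oracle_answer ?d (obj a' b') z"
      if "range a \<subseteq> Rn (dimX ?d)" "range b \<subseteq> Rn (dimY ?d)"
        "range a' \<subseteq> Rn (dimX ?d)" "range b' \<subseteq> Rn (dimY ?d)" "z \<in> dom_XY ?d"
        "\<And>q. q \<le> s \<Longrightarrow> a q = a' q \<and> b q = b' q"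
        "\<And>q. s \<le> q \<Longrightarrow> inner (a q) (fst z) = 0 \<and> inner (a' q) (fst z) = 0 \<and>
          inner (b q) (snd z) = 0 \<and> inner (b' q) (snd z) = 0" for a b a' b' z s
      using oracle_answer_local[OF _ _ _ _ R(1) that(5-7)] that(1-4) by simp
  qed (use R(1) differentiable_obj_obj in simp_all)
  have "ereal ?P \<le> hitting_time l \<epsilon> A ?d (obj a b)"
    unfolding hitting_time_def
  proof (rule INF_greatest)
    fix t assume "t \<in> {t. eps_OS l \<epsilon> ?d (obj a b) (fst (A ?d (obj a b) t))}"
    then have "inner (a (?P - 1)) (fst (A ?d (obj a b) t)) \<noteq> 0"
      using not_eps_OS_if_last_undiscovered[OF ab R(1) orth T \<epsilon> r R(2)] by blast
    \<comment> \<open>Every query with index up to \<open>?P - 1\<close> is orthogonal to the last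
      direction.\<close>
    then have "\<not> t \<le> ?P - 1" using undisc[of t "?P - 1"] T by auto
    then have "?P \<le> t" by simp
    then show "ereal ?P \<le> ereal t" by (simp only: ereal_less_eq of_nat_le_iff)
  qed
  then show ?thesis
    using obj_in_saddle_class[OF ab R(1) orth R(3) Delta] by blast
qed

end

section \<open>Choice of the parameters\<close>

lemma real_ge_1_imp_nat_floor:
  fixes x :: real
  assumes "1 \<le> x"
  obtains n :: nat where "0 < n" "real n \<le> x" "x \<le> 2 * n" "x \<le> Suc n"
proof
  have "real (nat \<lfloor>x\<rfloor>) = of_int \<lfloor>x\<rfloor>" "1 \<le> \<lfloor>x\<rfloor>" using assms by auto
  then show "0 < nat \<lfloor>x\<rfloor>" "real (nat \<lfloor>x\<rfloor>) \<le> x" "x \<le> real (2 * nat \<lfloor>x\<rfloor>)" "x \<le> real (Suc (nat \<lfloor>x\<rfloor>))"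
    unfolding of_nat_mult of_nat_Suc by linarith+
qed

theorem theorem3p2:
  shows "\<exists>c\<^sub>0 c\<^sub>1 :: real. c\<^sub>0 > 0 \<and> c\<^sub>1 > 0 \<and>
    (\<forall>l D \<Delta> \<epsilon> :: real. l > 0 \<and> D > 0 \<and> \<Delta> > 0 \<and> \<epsilon> > 0 \<and> \<epsilon> \<le> c\<^sub>0 * min (l * D) (sqrt (l * \<Delta>)) \<longrightarrow>
      complexity l \<epsilon> A_det (saddle_class l D \<Delta>) \<ge> ereal (c\<^sub>1 * (l\<^sup>2 * D * \<Delta> / \<epsilon> ^ 3)))"
proof (rule exI[of _ "1/128"], rule exI[of _ "1/262144"], intro conjI allI impI)
  fix l D \<Delta> \<epsilon> :: real
  assume asm: "l > 0 \<and> D > 0 \<and> \<Delta> > 0 \<and> \<epsilon> > 0 \<and> \<epsilon> \<le> 1/128 * min (l * D) (sqrt (l * \<Delta>))"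
  then have pos: "l > 0" "D > 0" "\<Delta> > 0" "\<epsilon> > 0" and "128 * \<epsilon> \<le> l * D" and "128 * \<epsilon> \<le> sqrt (l * \<Delta>)"
    by auto
  have "(128 * \<epsilon>)\<^sup>2 \<le> (sqrt (l * \<Delta>))\<^sup>2"
    using \<open>128 * \<epsilon> \<le> sqrt (l * \<Delta>)\<close> pos by (intro power_mono) auto
  then have "16384 * \<epsilon>\<^sup>2 \<le> l * \<Delta>" using pos by (simp add: power_mult_distrib)
  then have "1024 * \<epsilon>\<^sup>2 \<le> l * \<Delta>" using zero_le_power2[of \<epsilon>] by linarith
  then have "1 \<le> l * \<Delta> / (1024 * \<epsilon>\<^sup>2)" using pos by simp
  \<comment> \<open>With \<open>r = 128 * \<epsilon> / l\<close> each block uses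
    \<open>1024 * \<epsilon>\<^sup>2 / l\<close> of the budget \<open>\<Delta>\<close>.\<close>
  then obtain T :: nat where T: "0 < T" "T \<le> l * \<Delta> / (1024 * \<epsilon>\<^sup>2)" "l * \<Delta> / (1024 * \<epsilon>\<^sup>2) \<le> 2 * T"
    using real_ge_1_imp_nat_floor by metis
  have "1 \<le> l * D / (128 * \<epsilon>)" using \<open>128 * \<epsilon> \<le> l * D\<close> pos by simp
  \<comment> \<open>For \<open>R = D / 2\<close> the condition
    \<open>64 * \<epsilon> * K \<le> l * R\<close> reads
    \<open>K \<le> l * D / (128 * \<epsilon>)\<close>.\<close>
  then obtain K :: nat where K: "0 < K" "K \<le> l * D / (128 * \<epsilon>)" "l * D / (128 * \<epsilon>) \<le> Suc K"
    using real_ge_1_imp_nat_floor by metis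
  interpret hard_instance K T l "128 * \<epsilon> / l"
    using K pos by unfold_locales auto
  have "ereal (1/262144 * (l\<^sup>2 * D * \<Delta> / \<epsilon> ^ 3)) \<le> (SUP (d, f)\<in>saddle_class l D \<Delta>. hitting_time l \<epsilon> A d f)"
    if A: "A \<in> A_det" for A
  proof -
    have "l * (128 * \<epsilon> / l)\<^sup>2 / 16 * T \<le> \<Delta>"
      using T(2) pos by (simp add: field_simps power2_eq_square)
    moreover have "64 * \<epsilon> * K \<le> l * (D / 2)"
      using K(2) pos by (simp add: field_simps)
    ultimately obtain d f where df: "(d, f) \<in> saddle_class l D \<Delta>"
      and hit: "ereal (T * Suc K) \<le> hitting_time l \<epsilon> A d f"
      using hitting_time_ge[OF A T(1) pos(4), of "D / 2" D \<Delta>] pos by auto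
    \<comment> \<open>\<open>262144 = 2 * 1024 * 128\<close>: the factor 2 pays for rounding
      \<open>T\<close> down, while \<open>Suc K\<close> absorbs the rounding of
      \<open>K\<close>.\<close>
    have "1/262144 * (l\<^sup>2 * D * \<Delta> / \<epsilon> ^ 3) = (l * \<Delta> / (1024 * \<epsilon>\<^sup>2)) / 2 * (l * D / (128 * \<epsilon>))"
      by (simp add: power2_eq_square power3_eq_cube mult_ac)
    also have "\<dots> \<le> T * Suc K"
      using T(3) K(3) pos unfolding of_nat_mult by (intro mult_mono) auto
    finally have "ereal (1/262144 * (l\<^sup>2 * D * \<Delta> / \<epsilon> ^ 3)) \<le> ereal (T * Suc K)" by simp
    also note hit
    also have "hitting_time l \<epsilon> A d f \<le> (SUP (d, f)\<in>saddle_class l D \<Delta>. hitting_time l \<epsilon> A d f)"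
      using SUP_upper[OF df, of "\<lambda>(d, f). hitting_time l \<epsilon> A d f"] by simp
    finally show ?thesis .
  qed
  then show "complexity l \<epsilon> A_det (saddle_class l D \<Delta>) \<ge> ereal (1/262144 * (l\<^sup>2 * D * \<Delta> / \<epsilon> ^ 3))"
    unfolding complexity_def by (rule INF_greatest)
qed auto

end
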